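(* Let $C>0$ be a constant, and consider the stochastic block model with $k$ blocks, $n$ vertices and observation probability $\rho$ such that $n\rho\ge C\log n$. There exists a constant $\kappa>0$ such that if $\hat M$ is the output of USVT with input $(A,\rho,\tau)$, where $\tau=(1+\delta)\kappa\sqrt{n\rho}$ for some fixed constant $\delta>0$, then $$\mathrm{MSE}(\hat M)\le c''\min\left\{\frac{k}{n\rho},\,1\right\},$$ where $c''$ is a positive constant depending on $\kappa$ and $\delta$.
   Context: Stochastic block model with $k$ blocks (graphon model with finite label space): $\mathcal X=\{1,\dots,k\}$ with a probability distribution $\mu$, and $f:\mathcal X\times\mathcal X\to[0,1]$ is symmetric. The labels (communities) $x_1,\dots,x_n$ are drawn i.i.d. from $\mu$. The edge probability matrix $M\in[0,1]^{n\times n}$ has $M_{ij}=f(x_i,x_j)$ for $i\ne j$ and $M_{ii}=0$. With observation probability $\rho\in(0,1]$ (which may depend on $n$), the observed symmetric adjacency matrix $A$ has $A_{ii}=0$ and, conditional on $(x_1,\dots,x_n)$, the entries $A_{ij}=A_{ji}$, $1\le i<j\le n$, are independent with $A_{ij}\sim\mathrm{Bernoulli}(\rho M_{ij})$. USVT with input $(A,\rho,\tau)$, $\tau>0$: take a singular value decomposition $A=\sum_{i=1}^n s_iu_iv_i^\top$, $s_1\ge\cdots\ge s_n$, set $\hat A=\sum_{i:\,s_i\ge\tau}s_iu_iv_i^\top$ and $\tilde M=\hat A/\rho$. The output $\hat M$ is the symmetric matrix with $\hat M_{ii}=0$ and, for $i<j$, $\hat M_{ij}=\hat M_{ji}=\min\{1,\max\{0,\tilde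 M_{ij}\}\}$. $\mathrm{MSE}(\hat M)=\frac1{n^2}\mathbb E[\|M-\hat M\|_F^2]$, with $\|\cdot\|_F$ the Frobenius norm and the expectation over both $(x_i)$ and $A$. *)

theory Defs
  imports "HOL-Probability.Probability" "Jordan_Normal_Form.Matrix"
begin

text \<open>Vertices and matrix indices range over \<open>{0..<n}\<close>, labels over \<open>{1..k}\<close>.
  Both HOL-Analysis and Jordan_Normal_Form declare \<open>$\<close>, \<open>\<bullet>\<close> and a type \<open>vec\<close>;
  the latter are meant here.\<close>

unbundle no vec_syntax
unbundle no inner_syntax


section \<open>The stochastic block model\<close>

definition sbm_kernel :: "nat \<Rightarrow> nat pmf \<Rightarrow> (nat \<Rightarrow> nat \<Rightarrow> real) \<Rightarrow> bool" where
  "sbm_kernel k \<mu> f \<longleftrightarrow> set_pmf \<mu> \<subseteq> {1..k} \<and>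
     (\<forall>a\<in>{1..k}. \<forall>b\<in>{1..k}. f a b \<in> {0..1} \<and> f a b = f b a)"

definition edge_prob_mat :: "nat \<Rightarrow> (nat \<Rightarrow> nat \<Rightarrow> real) \<Rightarrow> (nat \<Rightarrow> nat) \<Rightarrow> real mat" where
  "edge_prob_mat n f x = mat n n (\<lambda>(i, j). if i = j then 0 else f (x i) (x j))"

text \<open>Only the values \<open>e (i, j)\<close> with \<open>i < j < n\<close> are used.\<close>

definition adjacency_mat :: "nat \<Rightarrow> (nat \<times> nat \<Rightarrow> bool) \<Rightarrow> real mat" where
  "adjacency_mat n e = mat n n (\<lambda>(i, j). if i = j then 0 else of_bool (e (min i j, max i j)))"

text \<open>Joint law of \<open>(M, A)\<close>: i.i.d. labels with law \<open>\<mu>\<close> and, given the labels,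
  independent Bernoulli edges. The values \<open>0\<close> and \<open>False\<close> are the dummy values
  of \<^const>\<open>Pi_pmf\<close> outside the index set.\<close>

definition sbm_pmf ::
    "nat \<Rightarrow> nat pmf \<Rightarrow> (nat \<Rightarrow> nat \<Rightarrow> real) \<Rightarrow> real \<Rightarrow> (real mat \<times> real mat) pmf" where
  "sbm_pmf n \<mu> f \<rho> =
     do { x \<leftarrow> Pi_pmf {..<n} 0 (\<lambda>_. \<mu>);
          let M = edge_prob_mat n f x;
          e \<leftarrow> Pi_pmf {(i, j). i < j \<and> j < n} False (\<lambda>ij. bernoulli_pmf (\<rho> * M $$ ij));
          return_pmf (M, adjacency_mat n e) }"


section \<open>Universal singular value thresholding\<close>

text \<open>\<open>A = (\<Sum>l<n. s l u l (v l)\<^sup>T)\<close> with \<open>s\<close> nonnegative and nonincreasing and both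
  \<open>u\<close> and \<open>v\<close> orthonormal.\<close>

definition is_svd ::
    "nat \<Rightarrow> real mat \<Rightarrow> (nat \<Rightarrow> real) \<Rightarrow> (nat \<Rightarrow> real Matrix.vec) \<Rightarrow> (nat \<Rightarrow> real Matrix.vec) \<Rightarrow> bool"
  where
  "is_svd n A s u v \<longleftrightarrow>
     (\<forall>l<n. 0 \<le> s l) \<and> (\<forall>l m. l \<le> m \<and> m < n \<longrightarrow> s m \<le> s l) \<and>
     (\<forall>l<n. u l \<in> carrier_vec n \<and> v l \<in> carrier_vec n) \<and>
     (\<forall>l<n. \<forall>m<n. u l \<bullet> u m = of_bool (l = m) \<and> v l \<bullet> v m = of_bool (l = m)) \<and>
     A = mat n n (\<lambda>(i, j). \<Sum>l<n. s l * u l $ i * v l $ j)"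

definition svd_threshold ::
    "nat \<Rightarrow> real \<Rightarrow> (nat \<Rightarrow> real) \<Rightarrow> (nat \<Rightarrow> real Matrix.vec) \<Rightarrow> (nat \<Rightarrow> real Matrix.vec) \<Rightarrow> real mat"
  where
  "svd_threshold n \<tau> s u v =
     mat n n (\<lambda>(i, j). \<Sum>l | l < n \<and> s l \<ge> \<tau>. s l * u l $ i * v l $ j)"

definition clip_mat :: "nat \<Rightarrow> real mat \<Rightarrow> real mat" where
  "clip_mat n B =
     mat n n (\<lambda>(i, j). if i = j then 0 else min 1 (max 0 (B $$ (min i j, max i j))))"

text \<open>A relation rather than a function, since the decomposition of \<open>A\<close> is not unique.\<close>

definition usvt_output :: "nat \<Rightarrow> real mat \<Rightarrow> real \<Rightarrow> real \<Rightarrow> real mat \<Rightarrow> bool" where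
  "usvt_output n A \<rho> \<tau> B \<longleftrightarrow>
     (\<exists>s u v. is_svd n A s u v \<and> B = clip_mat n ((1 / \<rho>) \<cdot>\<^sub>m svd_threshold n \<tau> s u v))"


section \<open>Mean squared error\<close>

definition frobenius_norm :: "real mat \<Rightarrow> real" where
  "frobenius_norm B = sqrt (\<Sum>i<dim_row B. \<Sum>j<dim_col B. (B $$ (i, j))\<^sup>2)"

text \<open>\<open>Mhat\<close> maps the observed adjacency matrix to the estimate of \<open>M\<close>.\<close>

definition MSE ::
    "nat \<Rightarrow> nat pmf \<Rightarrow> (nat \<Rightarrow> nat \<Rightarrow> real) \<Rightarrow> real \<Rightarrow> (real mat \<Rightarrow> real mat) \<Rightarrow> real" where
  "MSE n \<mu> f \<rho> Mhat =
     1 / (real n)\<^sup>2 *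
       measure_pmf.expectation (sbm_pmf n \<mu> f \<rho>) (\<lambda>(M, A). (frobenius_norm (M - Mhat A))\<^sup>2)"

end

theory Submission
  imports Defs
begin

text \<open>
  \<^emph>\<open>Noise.\<close> Let \<open>X = A - \<rho> M\<close>, given the labels. Expanding \<open>E tr X\<^bsup>2p\<^esup>\<close> over closed walks, only
  walks using every edge at least twice contribute, each at most \<open>\<rho>\<close> to the number of its edges.
  Comparing walks of equal shape, as Bandeira and van Handel do, bounds this by \<open>n / r\<close> times
  \<open>E tr Y\<^bsup>2p\<^esup>\<close>, where \<open>r = 2p\<close>, \<open>p \<ge> n \<rho>\<close> and \<open>Y\<close> is a dense \<open>r \<times> r\<close> matrix with bounded
  centred entries, whose norm is of order \<open>sqrt r\<close>. With \<open>p\<close> of order \<open>n \<rho> \<ge> C ln n\<close>, Markov's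
  inequality gives \<open>\<parallel>X\<parallel>\<^sup>2 \<le> K n \<rho>\<close> outside an event of probability \<open>1 / n\<close>, which contributes at
  most \<open>1 / n \<le> k / (n \<rho>)\<close> to the error.

  \<^emph>\<open>Thresholding.\<close> Let \<open>P\<close> be \<open>\<rho> M\<close> with its diagonal filled in according to the blocks, and \<open>Q\<close> the
  projection onto the span of the at most \<open>k\<close> block indicators, so that \<open>Q P = P\<close>. For every retained
  singular vector, \<open>s |(1 - Q) u| \<le> \<parallel>A - P\<parallel>\<close>; since \<open>s \<ge> \<tau> \<ge> (1 + \<delta>) \<parallel>A - P\<parallel>\<close>, Bessel's
  inequality shows that \<open>O(k)\<close> vectors are retained. The range of \<open>Q\<close> contributes at most
  \<open>k (\<tau> + \<parallel>A - P\<parallel>)\<^sup>2\<close> to the squared error, its complement \<open>O(k) \<parallel>A - P\<parallel>\<^sup>2\<close>.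
\<close>


section \<open>Powers and traces of symmetric matrices\<close>

text \<open>Matrices are index functions, of which only the entries below \<open>n\<close> matter.
  Powers grow on the right, so that \<open>mat_pow_Suc\<close> appends the last step of a
  walk.\<close>

definition mat_pow :: "nat \<Rightarrow> (nat \<Rightarrow> nat \<Rightarrow> real) \<Rightarrow> nat \<Rightarrow> nat \<Rightarrow> nat \<Rightarrow> real" where
  "mat_pow n X m = ((\<lambda>P i j. \<Sum>k<n. P i k * X k j) ^^ m) (\<lambda>i j. of_bool (i = j))"

lemma mat_pow_0 [simp]: "mat_pow n X 0 i j = of_bool (i = j)"
  by (simp add: mat_pow_def)

lemma mat_pow_Suc [simp]: "mat_pow n X (Suc m) i j = (\<Sum>k<n. mat_pow n X m i k * X k j)"
  by (simp add: mat_pow_def)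

lemma mat_pow_1: "i < n \<Longrightarrow> mat_pow n X (Suc 0) i j = X i j"
  by (simp add: of_bool_def if_distrib [of "\<lambda>x. x * _"] cong: if_cong)

lemma mat_pow_add:
  assumes "j < n"
  shows "mat_pow n X (a + b) i j = (\<Sum>k<n. mat_pow n X a i k * mat_pow n X b k j)"
  using assms
proof (induction b arbitrary: j)
  case 0
  then show ?case
    by (simp add: of_bool_def if_distrib [of "\<lambda>x. _ * x"] cong: if_cong)
next
  case (Suc b)
  have "mat_pow n X (a + Suc b) i j
      = (\<Sum>l<n. (\<Sum>k<n. mat_pow n X a i k * mat_pow n X b k l) * X l j)"
    using Suc.IH by simp
  also have "\<dots> = (\<Sum>k<n. \<Sum>l<n. mat_pow n X a i k * mat_pow n X b k l * X l j)"
    by (subst sum.swap) (simp add: sum_distrib_right)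
  also have "\<dots> = (\<Sum>k<n. mat_pow n X a i k * mat_pow n X (Suc b) k j)"
    by (simp add: sum_distrib_left mult.assoc)
  finally show ?case .
qed

definition sym_on :: "nat \<Rightarrow> (nat \<Rightarrow> nat \<Rightarrow> real) \<Rightarrow> bool" where
  "sym_on n X \<longleftrightarrow> (\<forall>i<n. \<forall>j<n. X i j = X j i)"

lemma mat_pow_sym:
  assumes "sym_on n X" "i < n" "j < n"
  shows "mat_pow n X m i j = mat_pow n X m j i"
  using assms(2,3)
proof (induction m arbitrary: i j)
  case (Suc m)
  have "mat_pow n X (Suc m) i j = (\<Sum>k<n. X j k * mat_pow n X m k i)"
    using Suc assms(1) by (simp add: sym_on_def mult.commute)
  also have "\<dots> = mat_pow n X (1 + m) j i"
    using Suc.prems by (subst mat_pow_add) (auto simp: mat_pow_1 simp del: mat_pow_Suc)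
  finally show ?case by simp
qed auto

definition mat_trace_pow :: "nat \<Rightarrow> (nat \<Rightarrow> nat \<Rightarrow> real) \<Rightarrow> nat \<Rightarrow> real" where
  "mat_trace_pow n X m = (\<Sum>i<n. mat_pow n X m i i)"

text \<open>By symmetry a diagonal entry of X^p X^p is the squared length of a row of X^p. Even
  traces are thus squared Frobenius norms, in particular nonnegative, as Markov's inequality
  requires.\<close>

lemma mat_trace_pow_double:
  assumes "sym_on n X"
  shows "mat_trace_pow n X (2 * p) = (\<Sum>i<n. \<Sum>j<n. (mat_pow n X p i j)\<^sup>2)"
  unfolding mat_trace_pow_def mult_2
  by (intro sum.cong refl) (auto simp: mat_pow_add power2_eq_square mat_pow_sym[OF assms])

lemma sum_mult_sum_swap:
  fixes f g :: "nat \<Rightarrow> real"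
  shows "(\<Sum>i\<in>A. f i * (\<Sum>j\<in>B. h i j * g j)) = (\<Sum>j\<in>B. (\<Sum>i\<in>A. f i * h i j) * g j)"
  by (simp add: sum_distrib_left sum_distrib_right mult.assoc) (rule sum.swap)

text \<open>For symmetric \<open>Y\<close> one has \<open>|Y v|\<^sup>2 = \<langle>v, Y\<^sup>2 v\<rangle> \<le> |v| |Y\<^sup>2 v|\<close>;
  iterating over \<open>Y = X, X\<^sup>2, X\<^sup>4, \<dots>\<close> avoids diagonalising \<open>X\<close>.\<close>

lemma norm_power_le_trace:
  assumes sym: "sym_on n X"
  shows "(\<Sum>i<n. (\<Sum>j<n. X i j * v j)\<^sup>2) ^ 2 ^ q
       \<le> mat_trace_pow n X (2 * 2 ^ q) * (\<Sum>i<n. (v i)\<^sup>2) ^ 2 ^ q"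
proof -
  define S where "S = (\<Sum>i<n. (v i)\<^sup>2)"
  \<comment> \<open>\<open>N q\<close> is |Y v|^2 for Y = X^(2^q).\<close>
  define N where "N q = (\<Sum>i<n. (\<Sum>j<n. mat_pow n X (2 ^ q) i j * v j)\<^sup>2)" for q
  have S0: "S \<ge> 0" and N0: "N q \<ge> 0" for q
    by (auto simp: S_def N_def intro!: sum_nonneg)
  have N_0: "N 0 = (\<Sum>i<n. (\<Sum>j<n. X i j * v j)\<^sup>2)"
    unfolding N_def by (intro sum.cong refl) (simp add: mat_pow_1 del: mat_pow_Suc)
  have step: "(N q)\<^sup>2 \<le> S * N (Suc q)" for q
  proof -
    let ?P = "mat_pow n X (2 ^ q)" and ?Q = "mat_pow n X (2 ^ Suc q)"
    have "N q = (\<Sum>i<n. (\<Sum>j<n. ?P i j * v j) * (\<Sum>k<n. ?P i k * v k))"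
      unfolding N_def by (simp add: power2_eq_square)
    also have "\<dots> = (\<Sum>k<n. (\<Sum>i<n. (\<Sum>j<n. ?P i j * v j) * ?P i k) * v k)"
      by (rule sum_mult_sum_swap)
    also have "\<dots> = (\<Sum>k<n. v k * (\<Sum>j<n. ?Q k j * v j))"
    proof (intro sum.cong refl)
      fix k assume k: "k \<in> {..<n}"
      have "(\<Sum>i<n. (\<Sum>j<n. ?P i j * v j) * ?P i k) = (\<Sum>i<n. ?P k i * (\<Sum>j<n. ?P i j * v j))"
        using k by (intro sum.cong refl) (simp add: mat_pow_sym[OF sym, of _ k] mult.commute)
      also have "\<dots> = (\<Sum>j<n. (\<Sum>i<n. ?P k i * ?P i j) * v j)"
        by (rule sum_mult_sum_swap)
      also have "\<dots> = (\<Sum>j<n. ?Q k j * v j)"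
        by (intro sum.cong refl) (simp add: mult_2 mat_pow_add)
      finally show "(\<Sum>i<n. (\<Sum>j<n. ?P i j * v j) * ?P i k) * v k = v k * (\<Sum>j<n. ?Q k j * v j)"
        by simp
    qed
    finally have "(N q)\<^sup>2 = (\<Sum>k<n. v k * (\<Sum>j<n. ?Q k j * v j))\<^sup>2" by simp
    also have "\<dots> \<le> S * N (Suc q)"
      unfolding S_def N_def by (rule Cauchy_Schwarz_ineq_sum)
    finally show ?thesis .
  qed
  \<comment> \<open>Cauchy-Schwarz in each row bounds |Y v|^2 by the squared Frobenius norm of Y
    times |v|^2, and that norm is an even trace.\<close>
  have N_le: "N q \<le> mat_trace_pow n X (2 * 2 ^ q) * S"
  proof -
    have "N q \<le> (\<Sum>i<n. (\<Sum>j<n. (mat_pow n X (2 ^ q) i j)\<^sup>2) * S)"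
      unfolding N_def S_def by (intro sum_mono Cauchy_Schwarz_ineq_sum)
    then show ?thesis by (simp add: mat_trace_pow_double[OF sym] sum_distrib_right)
  qed
  show ?thesis
  proof (cases "S = 0")
    case True
    then have v: "\<And>i. i < n \<Longrightarrow> v i = 0"
      unfolding S_def by (subst (asm) sum_nonneg_eq_0_iff) auto
    then show ?thesis by (auto simp: power_0_left)
  next
    case False
    with S0 have Sp: "S > 0" by simp
    \<comment> \<open>This is N 0 ^ 2^q \<le> S ^ (2^q - 1) * N q, multiplied by \<open>S\<close> to
      avoid the subtraction. Squaring it and inserting \<open>step\<close> gives the next
      case.\<close>
    have "N 0 ^ 2 ^ q * S \<le> S ^ 2 ^ q * N q"
    proof (induction q)
      case (Suc q)
      have "(N 0 ^ 2 ^ q * S)\<^sup>2 \<le> (S ^ 2 ^ q * N q)\<^sup>2"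
        using Suc N0 S0 by (intro power_mono) auto
      also have "\<dots> = S ^ 2 ^ Suc q * (N q)\<^sup>2"
        by (simp add: power_mult_distrib mult.commute[of 2] flip: power_mult)
      also have "\<dots> \<le> S ^ 2 ^ Suc q * (S * N (Suc q))"
        using step S0 by (intro mult_left_mono) auto
      finally have "S * (N 0 ^ 2 ^ Suc q * S) \<le> S * (S ^ 2 ^ Suc q * N (Suc q))"
        by (simp add: power_mult_distrib power2_eq_square mult.commute mult.left_commute
                 mult_2 power_add)
      then show ?case using Sp by simp
    qed simp
    also have "S ^ 2 ^ q * N q \<le> S ^ 2 ^ q * (mat_trace_pow n X (2 * 2 ^ q) * S)"
      using N_le S0 by (intro mult_left_mono) auto
    finally have "N 0 ^ 2 ^ q \<le> mat_trace_pow n X (2 * 2 ^ q) * S ^ 2 ^ q"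
      using Sp by (simp add: mult.commute mult.left_commute)
    then show ?thesis by (simp add: N_0 S_def)
  qed
qed

text \<open>A column of X^p arises from a unit vector by \<open>p\<close> applications of X, each
  multiplying the squared length by at most \<open>K\<close>. The trace adds up \<open>n\<close>
  columns.\<close>

lemma trace_le_norm_power:
  assumes sym: "sym_on n X"
    and K: "\<And>v. (\<Sum>i<n. (\<Sum>j<n. X i j * v j)\<^sup>2) \<le> K * (\<Sum>i<n. (v i)\<^sup>2)" and "K \<ge> 0"
  shows "mat_trace_pow n X (2 * p) \<le> real n * K ^ p"
proof -
  have "(\<Sum>i<n. (mat_pow n X p i j)\<^sup>2) \<le> K ^ p" if "j < n" for j
  proof (induction p)
    case 0
    have "(\<Sum>i<n. (of_bool (i = j) :: real)\<^sup>2) = 1"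
      using that by (simp add: of_bool_def if_distrib[of "\<lambda>x. x\<^sup>2"] cong: if_cong)
    then show ?case by simp
  next
    case (Suc p)
    have "(\<Sum>i<n. (mat_pow n X (Suc p) i j)\<^sup>2) = (\<Sum>i<n. (mat_pow n X (1 + p) i j)\<^sup>2)"
      by simp
    also have "\<dots> = (\<Sum>i<n. (\<Sum>k<n. X i k * mat_pow n X p k j)\<^sup>2)"
      using that by (subst mat_pow_add) (auto simp: mat_pow_1 simp del: mat_pow_Suc)
    also have "\<dots> \<le> K * (\<Sum>i<n. (mat_pow n X p i j)\<^sup>2)" by (rule K)
    also have "\<dots> \<le> K * K ^ p" using Suc \<open>K \<ge> 0\<close> by (intro mult_left_mono)
    finally show ?case by simp
  qed
  then have "(\<Sum>j<n. \<Sum>i<n. (mat_pow n X p i j)\<^sup>2) \<le> (\<Sum>j<n. K ^ p)"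
    by (intro sum_mono) auto
  then show ?thesis unfolding mat_trace_pow_double[OF sym] by (subst sum.swap) simp
qed


section \<open>Closed walks\<close>

definition closed_walks :: "nat \<Rightarrow> nat \<Rightarrow> (nat \<Rightarrow> nat) set" where
  "closed_walks n m = {w \<in> {..m} \<rightarrow>\<^sub>E {..<n}. w m = w 0}"

lemma finite_closed_walks [simp]: "finite (closed_walks n m)"
  unfolding closed_walks_def by (rule finite_subset[OF _ finite_PiE[of "{..m}" "\<lambda>_. {..<n}"]]) auto

text \<open>Expanding the matrix product gives one term per walk; the induction groups walks by
  their last vertex but one.\<close>

lemma mat_pow_eq_sum_walks:
  assumes "i < n" "j < n"
  shows "mat_pow n X m i j
       = (\<Sum>w | w \<in> {..m} \<rightarrow>\<^sub>E {..<n} \<and> w 0 = i \<and> w m = j. \<Prod>t<m. X (w t) (w (Suc t)))"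
  using assms(2)
proof (induction m arbitrary: j)
  case 0
  have "{w. w \<in> {..0::nat} \<rightarrow>\<^sub>E {..<n} \<and> w 0 = i \<and> w 0 = j}
      = (if i = j then {\<lambda>t\<in>{..0::nat}. i} else {})"
    using assms by (auto simp: PiE_def extensional_def fun_eq_iff Pi_def)
  then show ?case by simp
next
  case (Suc m)
  let ?W = "\<lambda>k. {w. w \<in> {..m} \<rightarrow>\<^sub>E {..<n} \<and> w 0 = i \<and> w m = k}"
  let ?W' = "{w. w \<in> {..m} \<rightarrow>\<^sub>E {..<n} \<and> w 0 = i}"
  have fin: "finite ?W'"
    by (rule finite_subset[OF _ finite_PiE[of "{..m}" "\<lambda>_. {..<n}"]]) auto
  have "mat_pow n X (Suc m) i j
      = (\<Sum>k<n. \<Sum>w\<in>?W k. (\<Prod>t<m. X (w t) (w (Suc t))) * X (w m) j)"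
    using Suc.IH by (simp add: sum_distrib_right)
  also have "\<dots> = (\<Sum>k<n. \<Sum>w | w \<in> ?W' \<and> w m = k. (\<Prod>t<m. X (w t) (w (Suc t))) * X (w m) j)"
    by (simp add: conj_assoc)
  also have "\<dots> = (\<Sum>w\<in>?W'. (\<Prod>t<m. X (w t) (w (Suc t))) * X (w m) j)"
    using fin by (intro sum.group) (auto simp: PiE_def Pi_def)
  also have "\<dots> = (\<Sum>w | w \<in> {..Suc m} \<rightarrow>\<^sub>E {..<n} \<and> w 0 = i \<and> w (Suc m) = j.
                    \<Prod>t<Suc m. X (w t) (w (Suc t)))"
  \<comment> \<open>Dropping the last vertex loses nothing, since it is prescribed to be
    \<open>j\<close>; the restriction keeps walks extensional.\<close>
  proof (rule sum.reindex_bij_witness[where i = "\<lambda>w. restrict w {..m}" and j = "\<lambda>w. w(Suc m := j)"],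
      goal_cases)
    case (1 w)
    then show ?case by (auto simp: PiE_def extensional_def fun_eq_iff)
  next
    case (2 w)
    then show ?case using Suc.prems by (auto simp: PiE_def extensional_def Pi_def)
  next
    case (3 w)
    then show ?case by (auto simp: PiE_def extensional_def fun_eq_iff le_Suc_eq)
  next
    case (4 w)
    then show ?case by (auto simp: PiE_def extensional_def Pi_def)
  next
    case (5 w)
    have "(\<Prod>t<m. X ((w(Suc m := j)) t) ((w(Suc m := j)) (Suc t))) = (\<Prod>t<m. X (w t) (w (Suc t)))"
      by (intro prod.cong) auto
    then show ?case by (simp add: lessThan_Suc mult.commute)
  qed
  finally show ?case .
qed

lemma mat_trace_pow_eq_sum_walks:
  "mat_trace_pow n X m = (\<Sum>w\<in>closed_walks n m. \<Prod>t<m. X (w t) (w (Suc t)))"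
proof -
  have "mat_trace_pow n X m
      = (\<Sum>i<n. \<Sum>w | w \<in> closed_walks n m \<and> w 0 = i. \<Prod>t<m. X (w t) (w (Suc t)))"
    unfolding mat_trace_pow_def
    by (intro sum.cong) (auto simp: mat_pow_eq_sum_walks closed_walks_def intro!: sum.cong)
  also have "\<dots> = (\<Sum>w\<in>closed_walks n m. \<Prod>t<m. X (w t) (w (Suc t)))"
    by (intro sum.group[OF finite_closed_walks]) (auto simp: closed_walks_def)
  finally show ?thesis .
qed

section \<open>Edges of a walk and their multiplicities\<close>

definition edge :: "nat \<Rightarrow> nat \<Rightarrow> nat \<times> nat" where
  "edge i j = (min i j, max i j)"

lemma edge_eq_iff: "edge a b = edge c d \<longleftrightarrow> a = c \<and> b = d \<or> a = d \<and> b = c"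
  by (auto simp: edge_def min_def max_def)

definition upper_pairs :: "nat \<Rightarrow> (nat \<times> nat) set" where
  "upper_pairs n = {(i, j). i < j \<and> j < n}"

lemma finite_upper_pairs [simp]: "finite (upper_pairs n)"
  by (rule finite_subset[of _ "{..<n} \<times> {..<n}"]) (auto simp: upper_pairs_def)

lemma edge_in_upper_pairs: "i < n \<Longrightarrow> j < n \<Longrightarrow> i \<noteq> j \<Longrightarrow> edge i j \<in> upper_pairs n"
  by (auto simp: edge_def upper_pairs_def min_def max_def)

abbreviation step_edge :: "(nat \<Rightarrow> nat) \<Rightarrow> nat \<Rightarrow> nat \<times> nat" where
  "step_edge w t \<equiv> edge (w t) (w (Suc t))"

definition loopless :: "nat \<Rightarrow> (nat \<Rightarrow> nat) \<Rightarrow> bool" where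
  "loopless m w \<longleftrightarrow> (\<forall>t<m. w t \<noteq> w (Suc t))"

definition edge_mult :: "nat \<Rightarrow> (nat \<Rightarrow> nat) \<Rightarrow> nat \<times> nat \<Rightarrow> nat" where
  "edge_mult m w e = card {t. t < m \<and> step_edge w t = e}"

text \<open>These walks alone can have nonzero expected weight for a symmetric matrix with zero
  diagonal and independent centred entries: a loop, or an edge used once, yields a factor 0.\<close>

definition good_walks :: "nat \<Rightarrow> nat \<Rightarrow> (nat \<Rightarrow> nat) set" where
  "good_walks n m = {w \<in> closed_walks n m. loopless m w \<and> (\<forall>t<m. edge_mult m w (step_edge w t) \<ge> 2)}"

lemma good_walks_subset: "good_walks n m \<subseteq> closed_walks n m"
  by (auto simp: good_walks_def)

lemma finite_good_walks [simp]: "finite (good_walks n m)"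
  by (rule finite_subset[OF good_walks_subset finite_closed_walks])

lemma edge_mult_pos: "e \<in> step_edge w ` {..<m} \<Longrightarrow> edge_mult m w e > 0"
  by (auto simp: edge_mult_def card_gt_0_iff)

text \<open>A walk traces a connected graph: a step to a new vertex uses a new edge, since an
  earlier use of that edge would have visited the vertex before.\<close>

lemma card_vertices_le: "card (w ` {..m}) \<le> Suc (card (step_edge w ` {..<m}))"
proof (induction m)
  case (Suc m)
  have V: "w ` {..Suc m} = insert (w (Suc m)) (w ` {..m})"
    by (simp add: atMost_Suc)
  have E: "step_edge w ` {..<Suc m} = insert (step_edge w m) (step_edge w ` {..<m})"
    by (simp add: lessThan_Suc)
  show ?case
  proof (cases "w (Suc m) \<in> w ` {..m}")
    case True
    then have "card (w ` {..Suc m}) = card (w ` {..m})" by (simp add: V insert_absorb)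
    also have "\<dots> \<le> Suc (card (step_edge w ` {..<Suc m}))"
      using Suc by (rule order_trans) (auto intro!: card_mono)
    finally show ?thesis .
  next
    case False
    then have "step_edge w m \<notin> step_edge w ` {..<m}"
      by (fastforce simp: edge_eq_iff)
    then have "card (step_edge w ` {..<Suc m}) = Suc (card (step_edge w ` {..<m}))"
      by (simp add: E)
    moreover have "card (w ` {..Suc m}) \<le> Suc (card (w ` {..m}))"
      unfolding V by (rule card_insert_le_m1) auto
    ultimately show ?thesis using Suc by simp
  qed
qed simp

text \<open>Double counting: each distinct edge takes up at least two of the \<open>2 * p\<close>
  steps.\<close>

lemma card_edges_good:
  assumes "w \<in> good_walks n (2 * p)"
  shows "card (step_edge w ` {..<2 * p}) \<le> p"
proof -
  let ?E = "step_edge w ` {..<2 * p}"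
  have "2 * card ?E = (\<Sum>e\<in>?E. 2)" by simp
  also have "\<dots> \<le> (\<Sum>e\<in>?E. \<Sum>t | t \<in> {..<2 * p} \<and> step_edge w t = e. 1)"
    using assms by (intro sum_mono) (auto simp: good_walks_def edge_mult_def)
  also have "\<dots> = 2 * p" by (subst sum.group) auto
  finally show ?thesis by simp
qed

lemma card_vertices_good:
  assumes "w \<in> good_walks n (2 * p)"
  shows "card (w ` {..2 * p}) \<le> Suc p"
  using card_vertices_le[of w "2 * p"] card_edges_good[OF assms] by simp

section \<open>Walks up to relabelling of vertices\<close>

definition same_shape :: "nat \<Rightarrow> (nat \<Rightarrow> nat) \<Rightarrow> (nat \<Rightarrow> nat) \<Rightarrow> bool" where
  "same_shape m w w' \<longleftrightarrow> (\<forall>s\<le>m. \<forall>t\<le>m. w s = w t \<longleftrightarrow> w' s = w' t)"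

lemma same_shape_sym: "same_shape m w w' \<longleftrightarrow> same_shape m w' w"
  by (auto simp: same_shape_def)

text \<open>Loops, closure and coincidences between edges depend only on which vertices of the walk
  coincide.\<close>

lemma same_shape_good:
  assumes "same_shape m w w'" "w \<in> good_walks n m" "w' \<in> {..m} \<rightarrow>\<^sub>E {..<r}"
  shows "w' \<in> good_walks r m"
proof -
  have *: "step_edge w s = step_edge w t \<longleftrightarrow> step_edge w' s = step_edge w' t" if "s < m" "t < m" for s t
    using assms(1) that by (auto simp: same_shape_def edge_eq_iff)
  have "edge_mult m w' (step_edge w' t) = edge_mult m w (step_edge w t)" if "t < m" for t
    unfolding edge_mult_def using *[OF _ that] by (intro arg_cong[of _ _ card]) auto
  moreover have "loopless m w'"
    using assms(1,2) by (auto simp: same_shape_def good_walks_def loopless_def)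
  moreover have "w' m = w' 0"
    using assms(1,2) by (auto simp: same_shape_def good_walks_def closed_walks_def)
  ultimately show ?thesis
    using assms(2,3) by (auto simp: good_walks_def closed_walks_def)
qed

text \<open>Counts the injections of an \<open>m\<close>-set into an \<open>r\<close>-set. For
  \<open>m > r\<close> the truncated subtraction produces a zero factor, as it should.\<close>

definition falling :: "nat \<Rightarrow> nat \<Rightarrow> nat" where
  "falling r m = (\<Prod>j=0..<m. r - j)"

lemma same_shape_relabel:
  assumes "same_shape m w w'"
  obtains h where "\<And>t. t \<le> m \<Longrightarrow> h (w t) = w' t" "inj_on h (w ` {..m})"
proof -
  \<comment> \<open>All positions at which \<open>w\<close> visits \<open>v\<close> carry the same
    value of \<open>w'\<close>, so any choice of position will do.\<close>
  define h where "h v = w' (SOME t. t \<le> m \<and> w t = v)" for v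
  have h: "h (w t) = w' t" if "t \<le> m" for t
  proof -
    have "(SOME s. s \<le> m \<and> w s = w t) \<le> m \<and> w (SOME s. s \<le> m \<and> w s = w t) = w t"
      by (rule someI[of _ t]) (use that in auto)
    then show ?thesis using assms that unfolding h_def same_shape_def by blast
  qed
  have "inj_on h (w ` {..m})"
  proof (rule inj_onI)
    fix x y assume "x \<in> w ` {..m}" "y \<in> w ` {..m}" and eq: "h x = h y"
    then obtain s t where st: "s \<le> m" "t \<le> m" "x = w s" "y = w t" by auto
    then have "w' s = w' t" using eq h by simp
    then show "x = y" using assms st by (simp add: same_shape_def)
  qed
  with h that show ?thesis by blast
qed

text \<open>The walks shaped like \<open>w\<close> correspond to the injections of its vertex set
  into \<open>{..<r}\<close>.\<close>

lemma card_same_shape: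
  "card {w' \<in> {..m} \<rightarrow>\<^sub>E {..<r}. same_shape m w w'} = falling r (card (w ` {..m}))"
proof -
  let ?V = "w ` {..m}"
  let ?H = "{h \<in> ?V \<rightarrow>\<^sub>E {..<r}. inj_on h ?V}"
  have "bij_betw (\<lambda>h. restrict (h \<circ> w) {..m}) ?H {w' \<in> {..m} \<rightarrow>\<^sub>E {..<r}. same_shape m w w'}"
  proof (rule bij_betwI')
    fix h h' assume h: "h \<in> ?H" "h' \<in> ?H"
    show "(restrict (h \<circ> w) {..m} = restrict (h' \<circ> w) {..m}) = (h = h')"
    proof
      assume eq: "restrict (h \<circ> w) {..m} = restrict (h' \<circ> w) {..m}"
      show "h = h'"
      proof
        fix v
        show "h v = h' v"
        proof (cases "v \<in> ?V")
          case True
          then obtain t where "t \<le> m" "v = w t" by auto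
          then show ?thesis using fun_cong[OF eq, of t] by simp
        next
          case False
          then show ?thesis using h by (auto simp: PiE_def extensional_def)
        qed
      qed
    qed simp
  next
    fix h assume "h \<in> ?H"
    then show "restrict (h \<circ> w) {..m} \<in> {w' \<in> {..m} \<rightarrow>\<^sub>E {..<r}. same_shape m w w'}"
      by (auto simp: same_shape_def PiE_def Pi_def inj_on_def)
  next
    fix w' assume w': "w' \<in> {w' \<in> {..m} \<rightarrow>\<^sub>E {..<r}. same_shape m w w'}"
    then obtain h0 where h0: "\<And>t. t \<le> m \<Longrightarrow> h0 (w t) = w' t" "inj_on h0 ?V"
      using same_shape_relabel by blast
    define h where "h = restrict h0 ?V"
    have hw: "h (w t) = w' t" if "t \<le> m" for t
      using h0(1) that by (simp add: h_def)
    have "inj_on h ?V" using h0(2) by (simp add: h_def cong: inj_on_cong)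
    moreover have "h (w t) < r" if "t \<le> m" for t
      using w' hw[OF that] that by (auto simp: PiE_def Pi_def)
    ultimately have "h \<in> ?H" by (auto simp: h_def PiE_def)
    moreover have "w' = restrict (h \<circ> w) {..m}"
      using w' hw by (auto simp: fun_eq_iff PiE_def extensional_def)
    ultimately show "\<exists>h\<in>?H. w' = restrict (h \<circ> w) {..m}" by blast
  qed
  then have "card {w' \<in> {..m} \<rightarrow>\<^sub>E {..<r}. same_shape m w w'} = card ?H"
    by (simp add: bij_betw_same_card)
  also have "\<dots> = falling r (card ?V)"
    by (subst card_inj_on_subset_funcset) (auto simp: falling_def)
  finally show ?thesis .
qed

lemma card_vertices_same_shape:
  assumes "same_shape m w w'"
  shows "card (w ` {..m}) = card (w' ` {..m})"
proof -
  obtain h where h: "\<And>t. t \<le> m \<Longrightarrow> h (w t) = w' t" "inj_on h (w ` {..m})"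
    using same_shape_relabel[OF assms] by blast
  have "h ` w ` {..m} = w' ` {..m}"
    unfolding image_image using h(1) by (intro image_cong) auto
  then show ?thesis using card_image[OF h(2)] by simp
qed

lemma falling_le: "falling n m \<le> n ^ m"
proof -
  have "falling n m \<le> (\<Prod>j=0..<m. n)" unfolding falling_def by (intro prod_mono) auto
  then show ?thesis by simp
qed

text \<open>The factors after the first are \<open>2 * p - j\<close> with
  \<open>j \<le> k \<le> p\<close>, hence at least \<open>p\<close>. The first factor is kept
  exactly and becomes the denominator in the comparison factor n / (2 p).\<close>

lemma falling_ge:
  assumes "Suc k \<le> Suc p"
  shows "2 * p * p ^ k \<le> falling (2 * p) (Suc k)"
proof -
  have "(\<Prod>j=1..<Suc k. p) \<le> (\<Prod>j=1..<Suc k. 2 * p - j)"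
    using assms by (intro prod_mono) auto
  then have "p ^ k \<le> (\<Prod>j=1..<Suc k. 2 * p - j)" by simp
  moreover have "falling (2 * p) (Suc k) = 2 * p * (\<Prod>j=1..<Suc k. 2 * p - j)"
    unfolding falling_def by (subst prod.atLeast_Suc_lessThan) auto
  ultimately show ?thesis by (metis mult_le_mono2)
qed

text \<open>A walk with \<open>m\<close> vertices has \<open>falling N m\<close> relabelings in a set of \<open>N\<close> vertices, so
  good walks in \<open>{..<n}\<close> and in \<open>{..<2 * p}\<close> can be compared shape by shape.\<close>

lemma sum_good_walks_le:
  fixes \<rho> :: real
  assumes \<rho>: "0 < \<rho>" "\<rho> \<le> 1" and p: "real n * \<rho> \<le> real p" "p \<ge> 1"
  shows "(\<Sum>w\<in>good_walks n (2 * p). \<rho> ^ card (step_edge w ` {..<2 * p}))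
       \<le> real n / real (2 * p) * real (card (good_walks (2 * p) (2 * p)))"
proof -
  let ?L = "2 * p" and ?r = "2 * p"
  let ?Gn = "good_walks n ?L" and ?Gr = "good_walks ?r ?L"
  define V where "V w = card (w ` {..?L})" for w :: "nat \<Rightarrow> nat"
  have V1: "V w = Suc (V w - 1)" for w
  proof -
    have "V w > 0" by (auto simp: V_def card_gt_0_iff)
    then show ?thesis by simp
  qed
  have cnt: "card {w' \<in> good_walks N ?L. same_shape ?L w w'} = falling N (V w)"
    if "w \<in> good_walks M ?L" for w N M
  proof -
    have "{w' \<in> good_walks N ?L. same_shape ?L w w'} = {w' \<in> {..?L} \<rightarrow>\<^sub>E {..<N}. same_shape ?L w w'}"
      using same_shape_good that by (auto simp: good_walks_def closed_walks_def)
    then show ?thesis by (simp add: card_same_shape V_def)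
  qed
  have ge: "real ?r * real p ^ (V w - 1) \<le> real (falling ?r (V w))" if "w \<in> good_walks N ?L" for w N
  proof -
    have "V w \<le> Suc p" using card_vertices_good[OF that] by (simp add: V_def)
    then have "?r * p ^ (V w - 1) \<le> falling ?r (V w)"
      using falling_ge[of "V w - 1" p] V1[of w] by simp
    then show ?thesis by (metis of_nat_le_iff of_nat_mult of_nat_power)
  qed
  have pos: "real (falling ?r (V w)) > 0" if "w \<in> good_walks N ?L" for w N
    using p by (intro less_le_trans[OF _ ge[OF that]]) auto
  \<comment> \<open>As \<open>\<rho> \<le> 1\<close> and there are at least \<open>V w - 1\<close>
    edges, the weight may be expressed by the number of vertices.\<close>
  have "(\<Sum>w\<in>?Gn. \<rho> ^ card (step_edge w ` {..<?L})) \<le> (\<Sum>w\<in>?Gn. \<rho> ^ (V w - 1))"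
  proof (intro sum_mono power_decreasing)
    fix w
    show "V w - 1 \<le> card (step_edge w ` {..<?L})"
      using card_vertices_le[of w ?L] by (simp add: V_def)
  qed (use \<rho> in auto)
  \<comment> \<open>Each weight is spread evenly over the equally shaped good walks in
    \<open>{..<2 * p}\<close>; their number \<open>falling (2 * p) (V w)\<close> is
    positive.\<close>
  also have "\<dots> = (\<Sum>w\<in>?Gn. \<Sum>w' | w' \<in> ?Gr \<and> same_shape ?L w w'. \<rho> ^ (V w' - 1) / real (falling ?r (V w')))"
  proof (intro sum.cong refl)
    fix w assume w: "w \<in> ?Gn"
    have "(\<Sum>w' | w' \<in> ?Gr \<and> same_shape ?L w w'. \<rho> ^ (V w' - 1) / real (falling ?r (V w')))
        = (\<Sum>w' | w' \<in> ?Gr \<and> same_shape ?L w w'. \<rho> ^ (V w - 1) / real (falling ?r (V w)))"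
      by (intro sum.cong) (auto simp: V_def dest: card_vertices_same_shape)
    also have "\<dots> = \<rho> ^ (V w - 1)"
      using cnt[OF w] pos[OF w] by simp
    finally show "\<rho> ^ (V w - 1) = (\<Sum>w' | w' \<in> ?Gr \<and> same_shape ?L w w'. \<rho> ^ (V w' - 1) / real (falling ?r (V w')))"
      by simp
  qed
  also have "\<dots> = (\<Sum>w'\<in>?Gr. \<Sum>w | w \<in> ?Gn \<and> same_shape ?L w w'. \<rho> ^ (V w' - 1) / real (falling ?r (V w')))"
    by (rule sum.swap_restrict) auto
  also have "\<dots> = (\<Sum>w'\<in>?Gr. real (falling n (V w')) * (\<rho> ^ (V w' - 1) / real (falling ?r (V w'))))"
    using cnt by (intro sum.cong refl) (simp add: same_shape_sym[of _ _ "_ :: nat \<Rightarrow> nat"])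
  \<comment> \<open>After the exchange of sums a reference walk is weighted by its relabellings in
    \<open>{..<n}\<close>. With k = V w - 1 its total is at most n / (2 p) times (n \<rho> / p)^k,
    and n \<rho> \<le> p.\<close>
  also have "\<dots> \<le> (\<Sum>w'\<in>?Gr. real n / real ?r)"
  proof (intro sum_mono)
    fix w assume w: "w \<in> ?Gr"
    let ?k = "V w - 1"
    have "real (falling n (V w)) * (\<rho> ^ ?k / real (falling ?r (V w)))
        \<le> real n ^ V w * (\<rho> ^ ?k / (real ?r * real p ^ ?k))"
      using falling_le[of n "V w"] ge[OF w] \<rho> p
      by (intro mult_mono divide_left_mono) (auto simp flip: of_nat_power intro!: mult_pos_pos pos[OF w])
    also have "real n ^ V w = real n * real n ^ ?k" by (subst V1) simp
    also have "real n * real n ^ ?k * (\<rho> ^ ?k / (real ?r * real p ^ ?k))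
        = real n / real ?r * ((real n * \<rho>) ^ ?k / real p ^ ?k)"
      by (simp add: power_mult_distrib)
    also have "\<dots> \<le> real n / real ?r * 1"
      using \<rho> p by (intro mult_left_mono) (auto simp: divide_le_eq_1 intro!: power_mono)
    finally show "real (falling n (V w)) * (\<rho> ^ ?k / real (falling ?r (V w))) \<le> real n / real ?r"
      by simp
  qed
  finally show ?thesis by (simp add: mult.commute)
qed


section \<open>Moments of symmetric random matrices\<close>

lemma finite_set_Pi_pmf:
  assumes "finite A" "\<And>x. x \<in> A \<Longrightarrow> finite (set_pmf (D x))"
  shows "finite (set_pmf (Pi_pmf A dflt D))"
  using assms by (simp add: set_Pi_pmf finite_PiE_dflt)

lemma integrable_Pi_pmf_bool:
  fixes D :: "'a \<Rightarrow> bool pmf" and f :: "_ \<Rightarrow> real"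
  assumes "finite A"
  shows "integrable (measure_pmf (Pi_pmf A dflt D)) f"
  using assms by (intro integrable_measure_pmf_finite finite_set_Pi_pmf) auto

lemma expectation_prod_Pi_pmf_bool:
  fixes D :: "'a \<Rightarrow> bool pmf" and f :: "'a \<Rightarrow> bool \<Rightarrow> real"
  assumes "finite A"
  shows "measure_pmf.expectation (Pi_pmf A dflt D) (\<lambda>\<omega>. \<Prod>x\<in>A. f x (\<omega> x))
       = (\<Prod>x\<in>A. measure_pmf.expectation (D x) (f x))"
proof -
  let ?M = "measure_pmf (Pi_pmf A dflt D)"
  have "prob_space.indep_vars ?M (\<lambda>_. borel) (\<lambda>x \<omega>. f x (\<omega> x)) A"
    by (rule prob_space.indep_vars_compose2[OF measure_pmf.prob_space_axioms indep_vars_Pi_pmf[OF assms]])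
       auto
  then have "(\<integral>\<omega>. (\<Prod>x\<in>A. f x (\<omega> x)) \<partial>?M) = (\<Prod>x\<in>A. \<integral>\<omega>. f x (\<omega> x) \<partial>?M)"
    using assms
    by (intro prob_space.indep_vars_lebesgue_integral[OF measure_pmf.prob_space_axioms]
          integrable_Pi_pmf_bool)
  also have "\<dots> = (\<Prod>x\<in>A. measure_pmf.expectation (map_pmf (\<lambda>\<omega>. \<omega> x) (Pi_pmf A dflt D)) (f x))"
    by simp
  also have "\<dots> = (\<Prod>x\<in>A. measure_pmf.expectation (D x) (f x))"
    by (intro prod.cong refl) (simp add: Pi_pmf_component[OF assms])
  finally show ?thesis .
qed

definition sym_mat :: "(nat \<times> nat \<Rightarrow> bool \<Rightarrow> real) \<Rightarrow> (nat \<times> nat \<Rightarrow> bool) \<Rightarrow> nat \<Rightarrow> nat \<Rightarrow> real" where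
  "sym_mat g \<omega> i j = (if i = j then 0 else g (edge i j) (\<omega> (edge i j)))"

lemma sym_on_sym_mat: "sym_on n (sym_mat g \<omega>)"
  by (auto simp: sym_on_def sym_mat_def edge_def min.commute max.commute)

abbreviation edge_law :: "nat \<Rightarrow> (nat \<times> nat \<Rightarrow> bool pmf) \<Rightarrow> (nat \<times> nat \<Rightarrow> bool) pmf" where
  "edge_law n D \<equiv> Pi_pmf (upper_pairs n) False D"

text \<open>The factors are grouped by edge, after which independence applies; edges off the walk
  have exponent 0 and contribute 1.\<close>

lemma expectation_walk:
  assumes w: "w \<in> closed_walks n m" and l: "loopless m w"
  shows "measure_pmf.expectation (edge_law n D) (\<lambda>\<omega>. \<Prod>t<m. sym_mat g \<omega> (w t) (w (Suc t)))
       = (\<Prod>x\<in>step_edge w ` {..<m}. measure_pmf.expectation (D x) (\<lambda>b. g x b ^ edge_mult m w x))"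
proof -
  have sub: "step_edge w ` {..<m} \<subseteq> upper_pairs n"
    using w l by (auto simp: closed_walks_def PiE_iff loopless_def intro!: edge_in_upper_pairs)
  have "(\<Prod>t<m. sym_mat g \<omega> (w t) (w (Suc t))) = (\<Prod>x\<in>upper_pairs n. g x (\<omega> x) ^ edge_mult m w x)"
    for \<omega>
  proof -
    have "(\<Prod>t<m. sym_mat g \<omega> (w t) (w (Suc t))) = (\<Prod>t<m. g (step_edge w t) (\<omega> (step_edge w t)))"
      using l by (intro prod.cong) (auto simp: sym_mat_def loopless_def)
    also have "\<dots> = (\<Prod>x\<in>upper_pairs n. \<Prod>t | t \<in> {..<m} \<and> step_edge w t = x.
                        g (step_edge w t) (\<omega> (step_edge w t)))"
      using sub by (intro prod.group[symmetric]) auto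
    also have "\<dots> = (\<Prod>x\<in>upper_pairs n. g x (\<omega> x) ^ edge_mult m w x)"
      by (intro prod.cong refl) (simp add: edge_mult_def)
    finally show ?thesis .
  qed
  then have "measure_pmf.expectation (edge_law n D) (\<lambda>\<omega>. \<Prod>t<m. sym_mat g \<omega> (w t) (w (Suc t)))
      = (\<Prod>x\<in>upper_pairs n. measure_pmf.expectation (D x) (\<lambda>b. g x b ^ edge_mult m w x))"
    by (simp add: expectation_prod_Pi_pmf_bool[where f = "\<lambda>x b. g x b ^ edge_mult m w x"])
  also have "\<dots> = (\<Prod>x\<in>step_edge w ` {..<m}. measure_pmf.expectation (D x) (\<lambda>b. g x b ^ edge_mult m w x))"
  proof (rule prod.mono_neutral_right)
    show "\<forall>x\<in>upper_pairs n - step_edge w ` {..<m}. measure_pmf.expectation (D x) (\<lambda>b. g x b ^ edge_mult m w x) = 1"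
    proof
      fix x assume "x \<in> upper_pairs n - step_edge w ` {..<m}"
      then have "{t. t < m \<and> step_edge w t = x} = {}" by auto
      then have "edge_mult m w x = 0" unfolding edge_mult_def by simp
      then show "measure_pmf.expectation (D x) (\<lambda>b. g x b ^ edge_mult m w x) = 1" by simp
    qed
  qed (use sub in auto)
  finally show ?thesis .
qed

lemma expectation_trace:
  "measure_pmf.expectation (edge_law n D) (\<lambda>\<omega>. mat_trace_pow n (sym_mat g \<omega>) m)
     = (\<Sum>w\<in>closed_walks n m. measure_pmf.expectation (edge_law n D)
          (\<lambda>\<omega>. \<Prod>t<m. sym_mat g \<omega> (w t) (w (Suc t))))"
  unfolding mat_trace_pow_eq_sum_walks
  by (intro Bochner_Integration.integral_sum integrable_Pi_pmf_bool finite_upper_pairs)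

lemma walk_prod_eq_0:
  assumes "\<not> loopless m w"
  shows "(\<Prod>t<m. sym_mat g \<omega> (w t) (w (Suc t))) = 0"
  using assms by (auto simp: loopless_def sym_mat_def)

text \<open>A walk with a loop meets the zero diagonal. Otherwise some edge is used exactly once,
  and its mean 0 splits off as a factor.\<close>

lemma expectation_walk_eq_0:
  assumes w: "w \<in> closed_walks n m" "w \<notin> good_walks n m"
    and g: "\<And>x. x \<in> upper_pairs n \<Longrightarrow> measure_pmf.expectation (D x) (g x) = 0"
  shows "measure_pmf.expectation (edge_law n D) (\<lambda>\<omega>. \<Prod>t<m. sym_mat g \<omega> (w t) (w (Suc t))) = 0"
proof (cases "loopless m w")
  case True
  with w obtain t where t: "t < m" "\<not> edge_mult m w (step_edge w t) \<ge> 2"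
    by (auto simp: good_walks_def)
  then have "edge_mult m w (step_edge w t) = 1"
    using edge_mult_pos[of "step_edge w t" w m] by auto
  moreover have "step_edge w t \<in> upper_pairs n"
    using w True t by (auto simp: closed_walks_def PiE_iff loopless_def intro!: edge_in_upper_pairs)
  ultimately have "measure_pmf.expectation (D (step_edge w t))
      (\<lambda>b. g (step_edge w t) b ^ edge_mult m w (step_edge w t)) = 0"
    using g by simp
  then show ?thesis
    unfolding expectation_walk[OF w(1) True] using t by (intro prod_zero) auto
qed (simp add: walk_prod_eq_0)

text \<open>On the surviving walks every edge has exponent at least two, so each distinct edge costs
  one factor \<open>\<rho>\<close>, however often it is used.\<close>

lemma expectation_trace_le:
  assumes "\<And>x. x \<in> upper_pairs n \<Longrightarrow> measure_pmf.expectation (D x) (g x) = 0"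
    and "\<And>x k. x \<in> upper_pairs n \<Longrightarrow> k \<ge> 2 \<Longrightarrow> \<bar>measure_pmf.expectation (D x) (\<lambda>b. g x b ^ k)\<bar> \<le> \<rho>"
  shows "measure_pmf.expectation (edge_law n D) (\<lambda>\<omega>. mat_trace_pow n (sym_mat g \<omega>) m)
       \<le> (\<Sum>w\<in>good_walks n m. \<rho> ^ card (step_edge w ` {..<m}))"
proof -
  have "measure_pmf.expectation (edge_law n D) (\<lambda>\<omega>. mat_trace_pow n (sym_mat g \<omega>) m)
     = (\<Sum>w\<in>good_walks n m. measure_pmf.expectation (edge_law n D)
          (\<lambda>\<omega>. \<Prod>t<m. sym_mat g \<omega> (w t) (w (Suc t))))"
    unfolding expectation_trace using expectation_walk_eq_0[where D = D and g = g, OF _ _ assms(1)]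
    by (intro sum.mono_neutral_right good_walks_subset) auto
  also have "\<dots> \<le> (\<Sum>w\<in>good_walks n m. \<rho> ^ card (step_edge w ` {..<m}))"
  proof (rule sum_mono)
    fix w assume w: "w \<in> good_walks n m"
    then have cl: "w \<in> closed_walks n m" and l: "loopless m w" by (auto simp: good_walks_def)
    let ?E = "\<lambda>x. measure_pmf.expectation (D x) (\<lambda>b. g x b ^ edge_mult m w x)"
    have "\<bar>?E x\<bar> \<le> \<rho>" if "x \<in> step_edge w ` {..<m}" for x
      using that w cl l
      by (intro assms(2)) (auto simp: good_walks_def closed_walks_def PiE_iff loopless_def intro!: edge_in_upper_pairs)
    then have "(\<Prod>x\<in>step_edge w ` {..<m}. \<bar>?E x\<bar>) \<le> (\<Prod>x\<in>step_edge w ` {..<m}. \<rho>)"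
      by (intro prod_mono) auto
    moreover have "(\<Prod>x\<in>step_edge w ` {..<m}. ?E x) \<le> (\<Prod>x\<in>step_edge w ` {..<m}. \<bar>?E x\<bar>)"
      unfolding abs_prod[symmetric] by (rule abs_ge_self)
    ultimately show "measure_pmf.expectation (edge_law n D) (\<lambda>\<omega>. \<Prod>t<m. sym_mat g \<omega> (w t) (w (Suc t)))
        \<le> \<rho> ^ card (step_edge w ` {..<m})"
      unfolding expectation_walk[OF cl l] by simp
  qed
  finally show ?thesis .
qed

text \<open>The reverse direction, meant for the reference matrix: a good walk contributes a product
  of moments that are all at least 1, so the trace counts good walks.\<close>

lemma card_good_walks_le_expectation_trace:
  assumes "\<And>x. x \<in> upper_pairs n \<Longrightarrow> measure_pmf.expectation (D x) (g x) = 0"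
    and "\<And>x k. x \<in> upper_pairs n \<Longrightarrow> k \<ge> 2 \<Longrightarrow> measure_pmf.expectation (D x) (\<lambda>b. g x b ^ k) \<ge> 1"
  shows "real (card (good_walks n m))
       \<le> measure_pmf.expectation (edge_law n D) (\<lambda>\<omega>. mat_trace_pow n (sym_mat g \<omega>) m)"
proof -
  have "real (card (good_walks n m)) = (\<Sum>w\<in>good_walks n m. 1)" by simp
  also have "\<dots> \<le> (\<Sum>w\<in>good_walks n m. measure_pmf.expectation (edge_law n D)
          (\<lambda>\<omega>. \<Prod>t<m. sym_mat g \<omega> (w t) (w (Suc t))))"
  proof (rule sum_mono)
    fix w assume w: "w \<in> good_walks n m"
    then have cl: "w \<in> closed_walks n m" and l: "loopless m w" by (auto simp: good_walks_def)
    show "1 \<le> measure_pmf.expectation (edge_law n D) (\<lambda>\<omega>. \<Prod>t<m. sym_mat g \<omega> (w t) (w (Suc t)))"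
      unfolding expectation_walk[OF cl l] using w cl l
      by (intro prod_ge_1 assms(2)) (auto simp: good_walks_def closed_walks_def PiE_iff loopless_def intro!: edge_in_upper_pairs)
  qed
  also have "\<dots> = measure_pmf.expectation (edge_law n D) (\<lambda>\<omega>. mat_trace_pow n (sym_mat g \<omega>) m)"
    unfolding expectation_trace using expectation_walk_eq_0[where D = D and g = g, OF _ _ assms(1)]
    by (intro sum.mono_neutral_left good_walks_subset) auto
  finally show ?thesis .
qed


section \<open>The dense reference matrix\<close>

text \<open>Integer points of norm at most 2 sqrt r, a finite substitute for the ball of radius sqrt
  r. The box makes finiteness immediate.\<close>

definition lattice_ball :: "nat \<Rightarrow> (nat \<Rightarrow> int) set" where
  "lattice_ball r = {a \<in> {..<r} \<rightarrow>\<^sub>E {- int (4 * r)..int (4 * r)}. (\<Sum>i<r. (a i)\<^sup>2) \<le> 4 * int r}"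

lemma finite_lattice_ball [simp]: "finite (lattice_ball r)"
  unfolding lattice_ball_def
  by (rule finite_subset[OF _ finite_PiE[of "{..<r}" "\<lambda>_. {- int (4 * r)..int (4 * r)}"]]) auto

lemma lattice_ball_norm:
  assumes "a \<in> lattice_ball r"
  shows "(\<Sum>i<r. (real_of_int (a i))\<^sup>2) \<le> 4 * real r"
proof -
  have "real_of_int (\<Sum>i<r. (a i)\<^sup>2) \<le> real_of_int (4 * int r)"
    using assms unfolding lattice_ball_def by (subst of_int_le_iff) auto
  then show ?thesis by simp
qed

lemma sum_half_power_abs: "(\<Sum>z = - int N..int N. (1 / 2 :: real) ^ nat \<bar>z\<bar>) = 3 - 2 * (1 / 2) ^ N"
proof (induction N)
  case (Suc N)
  have "{- int (Suc N)..int (Suc N)} = insert (- int (Suc N)) (insert (int (Suc N)) {- int N..int N})"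
    by auto
  then show ?case using Suc by (simp add: nat_add_distrib)
qed simp

text \<open>Give a point the weight 2^(-|a|^2). In the ball it is at least 2^(-4 r), while over the
  box the weights factorise into coordinate sums of at most 3. Hence the count is at most (3 *
  16)^r.\<close>

lemma card_lattice_ball: "real (card (lattice_ball r)) \<le> 48 ^ r"
proof -
  let ?I = "{- int (4 * r)..int (4 * r)}"
  have "real (card (lattice_ball r)) * (1 / 2) ^ (4 * r) = (\<Sum>a\<in>lattice_ball r. (1 / 2) ^ (4 * r))"
    by simp
  also have "\<dots> \<le> (\<Sum>a\<in>lattice_ball r. \<Prod>i<r. (1 / 2) ^ nat ((a i)\<^sup>2))"
  proof (rule sum_mono)
    fix a assume "a \<in> lattice_ball r"
    then have "(\<Sum>i<r. (a i)\<^sup>2) \<le> 4 * int r" by (simp add: lattice_ball_def)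
    moreover have "int (\<Sum>i<r. nat ((a i)\<^sup>2)) = (\<Sum>i<r. (a i)\<^sup>2)" by simp
    ultimately have "(\<Sum>i<r. nat ((a i)\<^sup>2)) \<le> 4 * r" by linarith
    then show "(1 / 2 :: real) ^ (4 * r) \<le> (\<Prod>i<r. (1 / 2) ^ nat ((a i)\<^sup>2))"
      unfolding power_sum[symmetric] by (intro power_decreasing) auto
  qed
  also have "\<dots> \<le> (\<Sum>a\<in>{..<r} \<rightarrow>\<^sub>E ?I. \<Prod>i<r. (1 / 2) ^ nat ((a i)\<^sup>2))"
    by (intro sum_mono2 finite_PiE prod_nonneg) (auto simp: lattice_ball_def)
  also have "\<dots> = (\<Prod>i<r. \<Sum>z\<in>?I. (1 / 2) ^ nat (z\<^sup>2))"
    by (rule prod_sum_PiE[symmetric]) auto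
  also have "\<dots> \<le> (\<Prod>i<r. 3)"
  proof (intro prod_mono conjI sum_nonneg)
    have "(\<Sum>z\<in>?I. (1 / 2 :: real) ^ nat (z\<^sup>2)) \<le> (\<Sum>z\<in>?I. (1 / 2) ^ nat \<bar>z\<bar>)"
    proof (intro sum_mono power_decreasing nat_mono)
      show "\<bar>z\<bar> \<le> z\<^sup>2" for z :: int
        using mult_left_mono[of 1 "\<bar>z\<bar>" "\<bar>z\<bar>"] by (cases "z = 0") (auto simp: power2_eq_square)
    qed auto
    also have "\<dots> \<le> 3" by (simp only: sum_half_power_abs) simp
    finally show "(\<Sum>z\<in>?I. (1 / 2 :: real) ^ nat (z\<^sup>2)) \<le> 3" .
  qed auto
  finally have "real (card (lattice_ball r)) \<le> 3 ^ r * 2 ^ (4 * r)"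
    by (simp add: power_one_over field_simps)
  also have "(3 :: real) ^ r * 2 ^ (4 * r) = 48 ^ r"
    by (subst power_mult, subst power_mult_distrib[symmetric]) simp
  finally show ?thesis .
qed

text \<open>Rounding every coordinate in the direction favoured by \<open>c\<close> only increases the linear
  functional; this replaces an \<open>\<epsilon>\<close>-net of the sphere.\<close>

lemma lattice_round:
  fixes x c :: "nat \<Rightarrow> real"
  assumes x: "(\<Sum>i<r. (x i)\<^sup>2) \<le> real r"
  shows "\<exists>a\<in>lattice_ball r. (\<Sum>i<r. c i * x i) \<le> (\<Sum>i<r. c i * real_of_int (a i))"
proof -
  define a where "a = (\<lambda>i\<in>{..<r}. if c i \<ge> 0 then \<lceil>x i\<rceil> else \<lfloor>x i\<rfloor>)"
  \<comment> \<open>Rounding moves a coordinate by at most 1; summing this estimate yields 2 r + 2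
    r, which explains the radius of \<open>lattice_ball\<close>.\<close>
  have "(real_of_int (a i))\<^sup>2 \<le> 2 * (x i)\<^sup>2 + 2" if "i < r" for i
  proof -
    have "\<bar>real_of_int (a i) - x i\<bar> \<le> 1" using that unfolding a_def by (simp; linarith)
    then have "(real_of_int (a i) - x i)\<^sup>2 \<le> 1" by (simp add: abs_square_le_1)
    moreover have "(real_of_int (a i))\<^sup>2 + (real_of_int (a i) - 2 * x i)\<^sup>2
        = 2 * (x i)\<^sup>2 + 2 * (real_of_int (a i) - x i)\<^sup>2"
      by (simp add: power2_eq_square algebra_simps)
    ultimately show ?thesis using zero_le_power2[of "real_of_int (a i) - 2 * x i"] by linarith
  qed
  then have "(\<Sum>i<r. (real_of_int (a i))\<^sup>2) \<le> (\<Sum>i<r. 2 * (x i)\<^sup>2 + 2)"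
    by (intro sum_mono) auto
  also have "\<dots> = 2 * (\<Sum>i<r. (x i)\<^sup>2) + 2 * real r"
    by (simp add: sum.distrib sum_distrib_left)
  finally have "real_of_int (\<Sum>i<r. (a i)\<^sup>2) \<le> real_of_int (4 * int r)"
    using x by simp
  then have norm: "(\<Sum>i<r. (a i)\<^sup>2) \<le> 4 * int r"
    by (simp only: of_int_le_iff)
  have "a i \<in> {- int (4 * r)..int (4 * r)}" if "i < r" for i
  proof -
    have "\<bar>a i\<bar> \<le> (a i)\<^sup>2"
      using mult_left_mono[of 1 "\<bar>a i\<bar>" "\<bar>a i\<bar>"] by (cases "a i = 0") (auto simp: power2_eq_square)
    also have "(a i)\<^sup>2 \<le> (\<Sum>i<r. (a i)\<^sup>2)"
      using that by (intro member_le_sum) auto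
    finally show ?thesis using norm by auto
  qed
  with norm have "a \<in> lattice_ball r"
    unfolding lattice_ball_def by (auto simp: a_def)
  moreover have "(\<Sum>i<r. c i * x i) \<le> (\<Sum>i<r. c i * real_of_int (a i))"
    by (intro sum_mono) (auto simp: a_def intro: mult_left_mono mult_left_mono_neg)
  ultimately show ?thesis by blast
qed

definition bilin :: "nat \<Rightarrow> (nat \<Rightarrow> nat \<Rightarrow> real) \<Rightarrow> (nat \<Rightarrow> real) \<Rightarrow> (nat \<Rightarrow> real) \<Rightarrow> real" where
  "bilin n Y x y = (\<Sum>i<n. x i * (\<Sum>j<n. Y i j * y j))"

text \<open>With one argument fixed the form is linear in the other, so the two can be rounded in
  turn.\<close>

lemma bilin_lattice_bound:
  assumes M: "\<And>a b. a \<in> lattice_ball r \<Longrightarrow> b \<in> lattice_ball r \<Longrightarrow> bilin r Y (\<lambda>i. real_of_int (a i)) (\<lambda>i. real_of_int (b i)) \<le> M"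
    and x: "(\<Sum>i<r. (x i)\<^sup>2) \<le> real r" and y: "(\<Sum>i<r. (y i)\<^sup>2) \<le> real r"
  shows "bilin r Y x y \<le> M"
proof -
  obtain a where a: "a \<in> lattice_ball r"
      "(\<Sum>i<r. (\<Sum>j<r. Y i j * y j) * x i) \<le> (\<Sum>i<r. (\<Sum>j<r. Y i j * y j) * real_of_int (a i))"
    using lattice_round[OF x, of "\<lambda>i. \<Sum>j<r. Y i j * y j"] by (elim bexE)
  obtain b where b: "b \<in> lattice_ball r"
      "(\<Sum>j<r. (\<Sum>i<r. real_of_int (a i) * Y i j) * y j) \<le> (\<Sum>j<r. (\<Sum>i<r. real_of_int (a i) * Y i j) * real_of_int (b j))"
    using lattice_round[OF y, of "\<lambda>j. \<Sum>i<r. real_of_int (a i) * Y i j"] by (elim bexE)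
  have "bilin r Y x y \<le> bilin r Y (\<lambda>i. real_of_int (a i)) y"
    using a(2) by (simp add: bilin_def mult.commute)
  also have "\<dots> \<le> bilin r Y (\<lambda>i. real_of_int (a i)) (\<lambda>i. real_of_int (b i))"
    using b(2) unfolding bilin_def sum_mult_sum_swap by simp
  also have "\<dots> \<le> M" using a(1) b(1) by (rule M)
  finally show ?thesis .
qed

text \<open>The form is tested on \<open>Y v\<close> and \<open>v\<close>, both scaled to squared
  length \<open>r\<close>, where its value is r |Y v| / |v|.\<close>

lemma lattice_norm_bound:
  assumes M: "\<And>a b. a \<in> lattice_ball r \<Longrightarrow> b \<in> lattice_ball r \<Longrightarrow> bilin r Y (\<lambda>i. real_of_int (a i)) (\<lambda>i. real_of_int (b i)) \<le> M"
    and r: "r > 0"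
  shows "(\<Sum>i<r. (\<Sum>j<r. Y i j * v j)\<^sup>2) \<le> (M / real r)\<^sup>2 * (\<Sum>i<r. (v i)\<^sup>2)"
proof -
  define w where "w i = (\<Sum>j<r. Y i j * v j)" for i
  define S where "S = (\<Sum>i<r. (v i)\<^sup>2)"
  define N where "N = (\<Sum>i<r. (w i)\<^sup>2)"
  have S0: "S \<ge> 0" and N0: "N \<ge> 0" by (auto simp: S_def N_def intro!: sum_nonneg)
  show ?thesis
  proof (cases "S = 0 \<or> N = 0")
    case True
    have "N = 0" if "S = 0"
    proof -
      have "v i = 0" if "i < r" for i
        using \<open>S = 0\<close> that unfolding S_def by (subst (asm) sum_nonneg_eq_0_iff) auto
      then show ?thesis by (simp add: N_def w_def)
    qed
    with True have "N = 0" by blast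
    then show ?thesis using S0 by (simp add: N_def S_def w_def)
  next
    case False
    with S0 N0 have S: "S > 0" and N: "N > 0" by auto
    let ?s = "sqrt (real r / S)" and ?t = "sqrt (real r / N)"
    have sq: "(\<Sum>i<r. (c * f i)\<^sup>2) = c\<^sup>2 * (\<Sum>i<r. (f i)\<^sup>2)" for c :: real and f :: "nat \<Rightarrow> real"
      by (simp add: power_mult_distrib sum_distrib_left)
    have "bilin r Y (\<lambda>i. ?t * w i) (\<lambda>i. ?s * v i) \<le> M"
      using S N by (intro bilin_lattice_bound[OF M]) (simp_all add: sq flip: S_def N_def)
    also have "bilin r Y (\<lambda>i. ?t * w i) (\<lambda>i. ?s * v i) = (\<Sum>i<r. (?t * ?s) * (w i)\<^sup>2)"
      unfolding bilin_def w_def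
      by (intro sum.cong refl) (simp add: power2_eq_square sum_distrib_left mult_ac)
    also have "\<dots> = ?t * ?s * N"
      by (simp add: N_def sum_distrib_left)
    finally have le: "?t * ?s * N \<le> M" .
    have "(?t * ?s * N)\<^sup>2 \<le> M\<^sup>2"
      using le S N by (intro power_mono) auto
    moreover have "(?t * ?s * N)\<^sup>2 = (real r)\<^sup>2 * N / S"
      using S N r by (simp add: power_mult_distrib power2_eq_square field_simps)
    ultimately have "N \<le> (M / real r)\<^sup>2 * S"
      using S r by (simp add: power_divide field_simps)
    then show ?thesis by (simp add: N_def S_def w_def)
  qed
qed

section \<open>Moments of the reference matrix\<close>

lemma power_le_fact_exp:
  fixes t :: real
  assumes "t \<ge> 0"
  shows "t ^ k \<le> fact k * exp t"
proof -
  have "sum (\<lambda>n. t ^ n /\<^sub>R fact n) {k} \<le> (\<Sum>n. t ^ n /\<^sub>R fact n)"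
    using assms by (intro sum_le_suminf summable_exp_generic) auto
  then have "inverse (fact k) * t ^ k \<le> exp t" by (simp add: exp_def)
  then show ?thesis by (simp add: field_simps)
qed

lemma even_power_le_fact_exp:
  fixes t :: real
  shows "t ^ (2 * p) \<le> fact (2 * p) * (exp t + exp (- t))"
proof -
  have "t ^ (2 * p) = \<bar>t\<bar> ^ (2 * p)" by (simp add: power_mult)
  also have "\<dots> \<le> fact (2 * p) * exp \<bar>t\<bar>" by (rule power_le_fact_exp) simp
  also have "\<dots> \<le> fact (2 * p) * (exp t + exp (- t))"
    by (intro mult_left_mono) (auto simp: abs_if)
  finally show ?thesis .
qed

text \<open>With the values \<open>2\<close> and \<open>-1\<close> instead of random signs, odd moments of order at least three
  are positive as well, so the observed matrix need not be symmetrised before the comparison.\<close>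

definition ref_value :: "bool \<Rightarrow> real" where
  "ref_value b = (if b then 2 else - 1)"

abbreviation ref_law :: "nat \<Rightarrow> (nat \<times> nat \<Rightarrow> bool) pmf" where
  "ref_law r \<equiv> edge_law r (\<lambda>_. bernoulli_pmf (1 / 3))"

text \<open>The moment is (2^k + 2 (-1)^k) / 3; for odd \<open>k\<close> one has 2^k \<ge>
  8.\<close>

lemma ref_moment_ge_1:
  assumes "k \<ge> 2"
  shows "measure_pmf.expectation (bernoulli_pmf (1 / 3)) (\<lambda>b. ref_value b ^ k) \<ge> 1"
proof -
  have "(2 :: real) ^ k \<ge> 2 ^ 2" using assms by (intro power_increasing) auto
  moreover have "(2 :: real) ^ k \<ge> 2 ^ 3" if "odd k"
  proof -
    have "k \<noteq> 2" using that by auto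
    then show ?thesis using assms by (intro power_increasing) auto
  qed
  ultimately show ?thesis by (cases "even k") (auto simp: ref_value_def)
qed

text \<open>Hoeffding's lemma for a centred variable in an interval of length 4 |c|, where (4 |c|)^2
  / 8 = 2 c^2.\<close>

lemma ref_mgf:
  "measure_pmf.expectation (bernoulli_pmf (1 / 3)) (\<lambda>b. exp (c * ref_value b)) \<le> exp (2 * c\<^sup>2)"
proof -
  let ?B = "bernoulli_pmf (1 / 3)"
  interpret interval_bounded_random_variable "measure_pmf ?B" "\<lambda>b. c * ref_value b" "- 2 * \<bar>c\<bar>" "2 * \<bar>c\<bar>"
    by unfold_locales (auto simp: AE_measure_pmf_iff ref_value_def abs_if)
  have "nn_integral ?B (\<lambda>b. exp (1 * (c * ref_value b))) \<le> ennreal (exp (1\<^sup>2 * (2 * \<bar>c\<bar> - - 2 * \<bar>c\<bar>)\<^sup>2 / 8))"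
    by (rule Hoeffdings_lemma_nn_integral_0) (auto simp: ref_value_def)
  also have "nn_integral ?B (\<lambda>b. exp (1 * (c * ref_value b)))
      = ennreal (measure_pmf.expectation ?B (\<lambda>b. exp (c * ref_value b)))"
    by (subst nn_integral_eq_integral) (auto intro: integrable_measure_pmf_finite)
  finally show ?thesis
    by (subst (asm) ennreal_le_iff) (simp_all add: power2_eq_square)
qed

lemma sum_offdiag:
  fixes F :: "nat \<Rightarrow> nat \<Rightarrow> real"
  shows "(\<Sum>i<r. \<Sum>j<r. if i = j then 0 else F i j) = (\<Sum>(i, j)\<in>upper_pairs r. F i j + F j i)"
proof -
  let ?G = "\<lambda>(i, j). if i = j then 0 else F i j"
  have "(\<Sum>i<r. \<Sum>j<r. if i = j then 0 else F i j) = sum ?G ({..<r} \<times> {..<r})"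
    by (simp add: sum.cartesian_product)
  also have "\<dots> = sum ?G (upper_pairs r \<union> prod.swap ` upper_pairs r)"
    by (intro sum.mono_neutral_right) (auto simp: upper_pairs_def image_iff split: if_splits)
  also have "\<dots> = sum ?G (upper_pairs r) + sum ?G (prod.swap ` upper_pairs r)"
    by (intro sum.union_disjoint finite_imageI finite_upper_pairs) (auto simp: upper_pairs_def)
  also have "sum ?G (prod.swap ` upper_pairs r) = sum (?G \<circ> prod.swap) (upper_pairs r)"
    by (intro sum.reindex) auto
  also have "sum ?G (upper_pairs r) + \<dots> = (\<Sum>(i, j)\<in>upper_pairs r. F i j + F j i)"
    unfolding sum.distrib[symmetric] by (intro sum.cong) (auto simp: upper_pairs_def)
  finally show ?thesis .
qed

text \<open>The form is a linear combination of independent bounded centred variables, hence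
  sub-Gaussian, and its exponential moments control the even powers.\<close>

lemma ref_bilin_moment:
  assumes a: "(\<Sum>i<r. (a i)\<^sup>2) \<le> 4 * real r" and b: "(\<Sum>i<r. (b i)\<^sup>2) \<le> 4 * real r" and r: "r > 0"
  shows "measure_pmf.expectation (ref_law r) (\<lambda>\<omega>. bilin r (sym_mat (\<lambda>_. ref_value) \<omega>) a b ^ (2 * p))
       \<le> real r ^ p * fact (2 * p) * 2 * exp (64 * real r)"
proof -
  define c where "c = (\<lambda>(i, j). a i * b j + a j * b i)"
  define Z where "Z \<omega> = bilin r (sym_mat (\<lambda>_. ref_value) \<omega>) a b" for \<omega>
  let ?E = "measure_pmf.expectation (ref_law r)"
  have Z: "Z \<omega> = (\<Sum>e\<in>upper_pairs r. c e * ref_value (\<omega> e))" for \<omega>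
  proof -
    have "Z \<omega> = (\<Sum>i<r. \<Sum>j<r. if i = j then 0 else a i * ref_value (\<omega> (edge i j)) * b j)"
      unfolding Z_def bilin_def sum_distrib_left sym_mat_def
      by (intro sum.cong refl) auto
    also have "\<dots> = (\<Sum>e\<in>upper_pairs r. c e * ref_value (\<omega> e))"
      unfolding sum_offdiag
      by (intro sum.cong refl) (auto simp: upper_pairs_def edge_def c_def min_def max_def algebra_simps)
    finally show ?thesis .
  qed
  \<comment> \<open>The square of a i b j + a j b i is at most twice the sum of the two squares; the
    full double sum is then 2 |a|^2 |b|^2 \<le> 2 (4 r)^2.\<close>
  have c2: "(\<Sum>e\<in>upper_pairs r. (c e)\<^sup>2) \<le> 32 * (real r)\<^sup>2"
  proof -
    let ?F = "\<lambda>i j. 2 * ((a i)\<^sup>2 * (b j)\<^sup>2)"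
    have "(\<Sum>e\<in>upper_pairs r. (c e)\<^sup>2) \<le> (\<Sum>(i, j)\<in>upper_pairs r. ?F i j + ?F j i)"
    proof (intro sum_mono, clarify)
      fix i j
      show "(c (i, j))\<^sup>2 \<le> ?F i j + ?F j i"
        using zero_le_power2[of "a i * b j - a j * b i"]
        by (simp add: c_def power2_eq_square algebra_simps)
    qed
    also have "\<dots> = (\<Sum>i<r. \<Sum>j<r. if i = j then 0 else ?F i j)"
      by (rule sum_offdiag[symmetric])
    also have "\<dots> \<le> (\<Sum>i<r. \<Sum>j<r. ?F i j)"
      by (intro sum_mono) auto
    also have "\<dots> = 2 * ((\<Sum>i<r. (a i)\<^sup>2) * (\<Sum>j<r. (b j)\<^sup>2))"
      unfolding sum_product by (simp only: sum_distrib_left)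
    also have "\<dots> \<le> 2 * ((4 * real r) * (4 * real r))"
      using a b by (intro mult_left_mono mult_mono sum_nonneg) auto
    finally show ?thesis by (simp add: power2_eq_square)
  qed
  have mgf: "?E (\<lambda>\<omega>. exp (l * Z \<omega>)) \<le> exp (64 * real r)" if l: "l\<^sup>2 = 1 / real r" for l
  proof -
    have "?E (\<lambda>\<omega>. exp (l * Z \<omega>)) = ?E (\<lambda>\<omega>. \<Prod>e\<in>upper_pairs r. exp ((l * c e) * ref_value (\<omega> e)))"
      by (simp add: Z sum_distrib_left exp_sum mult.assoc)
    also have "\<dots> = (\<Prod>e\<in>upper_pairs r. measure_pmf.expectation (bernoulli_pmf (1 / 3))
                        (\<lambda>b. exp ((l * c e) * ref_value b)))"
      by (rule expectation_prod_Pi_pmf_bool) simp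
    also have "\<dots> \<le> (\<Prod>e\<in>upper_pairs r. exp (2 * (l * c e)\<^sup>2))"
      by (intro prod_mono conjI ref_mgf Bochner_Integration.integral_nonneg) auto
    also have "\<dots> = exp (2 * l\<^sup>2 * (\<Sum>e\<in>upper_pairs r. (c e)\<^sup>2))"
      by (simp add: exp_sum[symmetric] power_mult_distrib sum_distrib_left mult.assoc)
    also have "\<dots> \<le> exp (2 * l\<^sup>2 * (32 * (real r)\<^sup>2))"
      unfolding exp_le_cancel_iff using c2 by (intro mult_left_mono) auto
    also have "2 * l\<^sup>2 * (32 * (real r)\<^sup>2) = 64 * real r"
      unfolding l using r by (simp add: power2_eq_square)
    finally show ?thesis .
  qed
  \<comment> \<open>At this scale the exponent is linear in \<open>r\<close>, like the logarithm of
    the bound on the number of lattice pairs.\<close>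
  define l where "l = 1 / sqrt (real r)"
  have l2: "l\<^sup>2 = 1 / real r" by (simp add: l_def power_divide)
  have int: "integrable (measure_pmf (ref_law r)) f" for f :: "_ \<Rightarrow> real"
    by (rule integrable_Pi_pmf_bool) simp
  have "Z \<omega> ^ (2 * p) \<le> real r ^ p * fact (2 * p) * (exp (l * Z \<omega>) + exp (- l * Z \<omega>))" for \<omega>
  proof -
    have "(l * Z \<omega>)\<^sup>2 = (Z \<omega>)\<^sup>2 / real r" by (simp add: power_mult_distrib l2)
    then have "Z \<omega> ^ (2 * p) = real r ^ p * (l * Z \<omega>) ^ (2 * p)"
      using r by (simp add: power_mult power_divide)
    also have "\<dots> \<le> real r ^ p * (fact (2 * p) * (exp (l * Z \<omega>) + exp (- (l * Z \<omega>))))"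
      by (intro mult_left_mono even_power_le_fact_exp) auto
    finally show ?thesis by (simp add: mult.assoc)
  qed
  then have "?E (\<lambda>\<omega>. Z \<omega> ^ (2 * p))
      \<le> ?E (\<lambda>\<omega>. real r ^ p * fact (2 * p) * (exp (l * Z \<omega>) + exp (- l * Z \<omega>)))"
    by (intro integral_mono int)
  also have "\<dots> = real r ^ p * fact (2 * p) * (?E (\<lambda>\<omega>. exp (l * Z \<omega>)) + ?E (\<lambda>\<omega>. exp (- l * Z \<omega>)))"
    by (subst Bochner_Integration.integral_mult_right_zero, subst Bochner_Integration.integral_add)
       (auto intro: int)
  also have "\<dots> \<le> real r ^ p * fact (2 * p) * (exp (64 * real r) + exp (64 * real r))"
    using mgf[of l] mgf[of "- l"] l2 by (intro mult_left_mono add_mono) auto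
  finally show ?thesis by (simp add: Z_def)
qed

text \<open>The factors arise in \<open>ref_trace_bound\<close> with r = 2 p: \<open>48 ^ 4\<close>
  from the squared lattice count \<open>48 ^ r\<close>, \<open>exp 128\<close> from
  \<open>exp (64 * r)\<close>, and 4 from r^p = 2^p p^p together with 2 \<le> 2^p.\<close>

definition trace_const :: real where
  "trace_const = 4 * 48 ^ 4 * exp 128"

text \<open>The norm is governed by a maximum over lattice pairs, whose \<open>2 * p\<close>-th
  power is at most the sum of all \<open>2 * p\<close>-th powers; their expectations are
  known.\<close>

lemma ref_trace_bound:
  assumes p: "p \<ge> 1"
  shows "measure_pmf.expectation (ref_law (2 * p))
           (\<lambda>\<omega>. mat_trace_pow (2 * p) (sym_mat (\<lambda>_. ref_value) \<omega>) (2 * p))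
       \<le> real (2 * p) * (trace_const * real p) ^ p"
proof -
  define r where "r = 2 * p"
  let ?T = "lattice_ball r"
  let ?E = "measure_pmf.expectation (ref_law r)"
  define Z where "Z \<omega> = (\<lambda>(a, b). bilin r (sym_mat (\<lambda>_. ref_value) \<omega>) (\<lambda>i. real_of_int (a i)) (\<lambda>i. real_of_int (b i)))" for \<omega>
  have r: "r > 0" using p by (simp add: r_def)
  have int: "integrable (measure_pmf (ref_law r)) f" for f :: "_ \<Rightarrow> real"
    by (rule integrable_Pi_pmf_bool) simp
  have fin: "finite (?T \<times> ?T)" by simp
  have "mat_trace_pow r (sym_mat (\<lambda>_. ref_value) \<omega>) (2 * p)
      \<le> real r / real r ^ r * (\<Sum>ab\<in>?T \<times> ?T. Z \<omega> ab ^ (2 * p))" for \<omega>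
  proof -
    \<comment> \<open>Inserting 0 ensures that the maximum exists and is nonnegative.\<close>
    define M where "M = Max (insert 0 ((\<lambda>ab. \<bar>Z \<omega> ab\<bar>) ` (?T \<times> ?T)))"
    have M: "\<bar>Z \<omega> ab\<bar> \<le> M" if "ab \<in> ?T \<times> ?T" for ab
      unfolding M_def using that fin by (intro Max_ge) auto
    have "M \<in> insert 0 ((\<lambda>ab. \<bar>Z \<omega> ab\<bar>) ` (?T \<times> ?T))"
      unfolding M_def using fin by (intro Max_in) auto
    then have "M ^ (2 * p) \<le> (\<Sum>ab\<in>?T \<times> ?T. Z \<omega> ab ^ (2 * p))"
    proof (elim insertE imageE)
      assume "M = 0"
      then show ?thesis using p by (auto simp: power_0_left power_mult intro!: sum_nonneg)
    next
      fix ab assume ab: "M = \<bar>Z \<omega> ab\<bar>" "ab \<in> ?T \<times> ?T"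
      have "M ^ (2 * p) = Z \<omega> ab ^ (2 * p)" using ab by (simp add: power_mult)
      also have "\<dots> \<le> (\<Sum>ab\<in>?T \<times> ?T. Z \<omega> ab ^ (2 * p))"
        using ab fin by (intro member_le_sum) (auto simp: power_mult)
      finally show ?thesis .
    qed
    moreover have "mat_trace_pow r (sym_mat (\<lambda>_. ref_value) \<omega>) (2 * p) \<le> real r * ((M / real r)\<^sup>2) ^ p"
    proof (intro trace_le_norm_power sym_on_sym_mat lattice_norm_bound r)
      fix a b assume "a \<in> ?T" "b \<in> ?T"
      then show "bilin r (sym_mat (\<lambda>_. ref_value) \<omega>) (\<lambda>i. real_of_int (a i)) (\<lambda>i. real_of_int (b i)) \<le> M"
        using M[of "(a, b)"] by (simp add: Z_def)
    qed simp
    moreover have "((M / real r)\<^sup>2) ^ p = M ^ (2 * p) / real r ^ r"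
      unfolding power_mult[symmetric] by (simp only: power_divide r_def)
    ultimately show ?thesis
      using mult_left_mono[of "M ^ (2 * p)" "(\<Sum>ab\<in>?T \<times> ?T. Z \<omega> ab ^ (2 * p))" "real r / real r ^ r"]
      by simp
  qed
  then have "?E (\<lambda>\<omega>. mat_trace_pow r (sym_mat (\<lambda>_. ref_value) \<omega>) (2 * p))
      \<le> ?E (\<lambda>\<omega>. real r / real r ^ r * (\<Sum>ab\<in>?T \<times> ?T. Z \<omega> ab ^ (2 * p)))"
    by (intro integral_mono int)
  also have "\<dots> = real r / real r ^ r * (\<Sum>ab\<in>?T \<times> ?T. ?E (\<lambda>\<omega>. Z \<omega> ab ^ (2 * p)))"
    by (subst Bochner_Integration.integral_mult_right_zero, subst Bochner_Integration.integral_sum)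
       (auto intro: int)
  also have "\<dots> \<le> real r / real r ^ r * (\<Sum>ab\<in>?T \<times> ?T. real r ^ p * fact (2 * p) * 2 * exp (64 * real r))"
    using r lattice_ball_norm unfolding Z_def
    by (intro mult_left_mono sum_mono) (auto intro!: ref_bilin_moment)
  also have "\<dots> = real r / real r ^ r * ((real (card ?T))\<^sup>2 * (real r ^ p * fact r * 2 * exp (64 * real r)))"
    by (simp add: r_def card_cartesian_product power2_eq_square)
  \<comment> \<open>The factorial is at most \<open>r ^ r\<close> and cancels against the
    denominator; the remaining \<open>r ^ p\<close> reflects a norm of order sqrt r.\<close>
  also have "\<dots> \<le> real r / real r ^ r * ((48 ^ r)\<^sup>2 * (real r ^ p * real r ^ r * 2 ^ p * exp (64 * real r)))"
  proof -
    have "(fact r :: real) \<le> real r ^ r" using fact_le_power[of r, where 'a = real] by simp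
    moreover have "(2 :: real) \<le> 2 ^ p" using power_increasing[of 1 p "2 :: real"] p by simp
    ultimately show ?thesis
      by (intro mult_left_mono mult_mono power_mono card_lattice_ball) auto
  qed
  also have "\<dots> = real r * (trace_const * real p) ^ p"
  proof -
    have "exp (64 * real r) = exp 128 ^ p"
      by (simp add: r_def flip: exp_of_nat_mult)
    moreover have "(48 ^ r)\<^sup>2 = ((48 :: real) ^ 4) ^ p"
      unfolding r_def power_mult[symmetric] by (simp add: mult.commute)
    moreover have "real r ^ p = 2 ^ p * real p ^ p" by (simp add: r_def power_mult_distrib)
    moreover have "(4 :: real) ^ p = 2 ^ p * 2 ^ p" by (simp flip: power_mult_distrib)
    ultimately show ?thesis
      using r by (simp only: trace_const_def power_mult_distrib) simp
  qed
  finally show ?thesis by (simp add: r_def)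
qed

text \<open>The comparison passes through the number of good walks in \<open>{..<2 * p}\<close>; the
  dimension \<open>2 * p\<close> in the reference trace cancels against n / (2 p).\<close>

lemma expectation_trace_pow_le:
  assumes \<rho>: "0 < \<rho>" "\<rho> \<le> 1" and p: "real n * \<rho> \<le> real p" "p \<ge> 1"
    and g: "\<And>x. x \<in> upper_pairs n \<Longrightarrow> measure_pmf.expectation (D x) (g x) = 0"
      "\<And>x k. x \<in> upper_pairs n \<Longrightarrow> k \<ge> 2 \<Longrightarrow> \<bar>measure_pmf.expectation (D x) (\<lambda>b. g x b ^ k)\<bar> \<le> \<rho>"
  shows "measure_pmf.expectation (edge_law n D) (\<lambda>\<omega>. mat_trace_pow n (sym_mat g \<omega>) (2 * p))
       \<le> real n * (trace_const * real p) ^ p"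
proof -
  have "measure_pmf.expectation (edge_law n D) (\<lambda>\<omega>. mat_trace_pow n (sym_mat g \<omega>) (2 * p))
      \<le> (\<Sum>w\<in>good_walks n (2 * p). \<rho> ^ card (step_edge w ` {..<2 * p}))"
    by (rule expectation_trace_le[OF g])
  also have "\<dots> \<le> real n / real (2 * p) * real (card (good_walks (2 * p) (2 * p)))"
    by (rule sum_good_walks_le[OF \<rho> p])
  also have "\<dots> \<le> real n / real (2 * p) * measure_pmf.expectation (ref_law (2 * p))
           (\<lambda>\<omega>. mat_trace_pow (2 * p) (sym_mat (\<lambda>_. ref_value) \<omega>) (2 * p))"
    by (intro mult_left_mono card_good_walks_le_expectation_trace ref_moment_ge_1)
       (auto simp: ref_value_def)
  also have "\<dots> \<le> real n / real (2 * p) * (real (2 * p) * (trace_const * real p) ^ p)"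
    by (intro mult_left_mono ref_trace_bound p) auto
  also have "\<dots> = real n * (trace_const * real p) ^ p" using p by simp
  finally show ?thesis .
qed


section \<open>Spectral concentration\<close>

text \<open>The middle factor bounds p / (n \<rho>) after \<open>p\<close> has been rounded up to a
  power of two; \<open>exp (2 / C)\<close> brings the Markov ratio down to n exp (-2 p / C).\<close>

definition conc_const :: "real \<Rightarrow> real" where
  "conc_const C = trace_const * (2 + 1 / (C * ln 2)) * exp (2 / C)"

lemma trace_const_pos: "trace_const > 0"
  by (simp add: trace_const_def)

lemma conc_const_pos: "C > 0 \<Longrightarrow> conc_const C > 0"
  by (auto simp: conc_const_def trace_const_pos intro!: mult_pos_pos add_pos_pos)

text \<open>Supplies a moment order to which \<open>norm_power_le_trace\<close> applies. The least
  admissible exponent works; the summand 1 covers exponent 0.\<close>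

lemma power_of_two_between:
  fixes y :: real
  shows "\<exists>q. y \<le> 2 ^ q \<and> 2 ^ q \<le> 2 * \<bar>y\<bar> + 1"
proof -
  have ex: "\<exists>q. y \<le> 2 ^ q"
    using real_arch_pow[of 2 y] by (auto intro: less_imp_le)
  define q where "q = (LEAST q. y \<le> 2 ^ q)"
  have q: "y \<le> 2 ^ q" unfolding q_def using ex by (rule LeastI_ex)
  have "2 ^ q \<le> 2 * \<bar>y\<bar> + 1"
  proof (cases q)
    case (Suc q')
    then have "\<not> y \<le> 2 ^ q'" unfolding q_def by (intro not_less_Least) simp
    then show ?thesis using Suc by simp
  qed simp
  with q show ?thesis by blast
qed

lemma bernoulli_centred_moment:
  assumes q: "0 \<le> q" "q \<le> 1" and k: "k \<ge> 2"
  shows "\<bar>measure_pmf.expectation (bernoulli_pmf q) (\<lambda>b. (of_bool b - q) ^ k)\<bar> \<le> q"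
proof -
  have "\<bar>(1 - q) ^ k * q + (- q) ^ k * (1 - q)\<bar> \<le> (1 - q) ^ k * q + q ^ k * (1 - q)"
    using q by (intro order_trans[OF abs_triangle_ineq]) (auto simp: abs_mult power_abs)
  also have "\<dots> \<le> (1 - q) ^ 1 * q + q ^ 2 * 1"
    using q k by (intro add_mono mult_mono power_decreasing) auto
  also have "\<dots> = q" by (simp add: power2_eq_square algebra_simps)
  finally show ?thesis using q by simp
qed

lemma spectral_concentration:
  fixes q :: "nat \<times> nat \<Rightarrow> real"
  assumes C: "C > 0" and n: "n \<ge> 1" and \<rho>: "0 < \<rho>" "\<rho> \<le> 1" and deg: "real n * \<rho> \<ge> C * ln (real n)"
    and q: "\<And>x. x \<in> upper_pairs n \<Longrightarrow> 0 \<le> q x \<and> q x \<le> \<rho>"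
  shows "measure_pmf.prob (edge_law n (\<lambda>x. bernoulli_pmf (q x)))
           {\<omega>. \<exists>v. (\<Sum>i<n. (\<Sum>j<n. sym_mat (\<lambda>x b. of_bool b - q x) \<omega> i j * v j)\<^sup>2)
                  > conc_const C * (real n * \<rho>) * (\<Sum>i<n. (v i)\<^sup>2)} \<le> 1 / real n"
    (is "measure_pmf.prob ?D ?Bad \<le> _")
proof -
  define K where "K = conc_const C * (real n * \<rho>)"
  have K: "K > 0" using conc_const_pos[OF C] n \<rho> by (simp add: K_def)
  let ?X = "\<lambda>\<omega>. sym_mat (\<lambda>x b. of_bool b - q x) \<omega>"
  show ?thesis
  \<comment> \<open>For \<open>n = 1\<close> the logarithm vanishes and the degree condition gives
    no positive lower bound, but the matrix is then zero.\<close>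
  proof (cases "n = 1")
    case True
    have "K * (v 0)\<^sup>2 \<ge> 0" for v :: "nat \<Rightarrow> real" using K by simp
    then have "?Bad = {}" using True by (auto simp: sym_mat_def not_less K_def)
    then show ?thesis by simp
  next
    case False
    with n have n2: "n \<ge> 2" by simp
    define d where "d = real n * \<rho>"
    have d0: "d > 0" using n \<rho> by (simp add: d_def)
    obtain s where s: "d \<le> 2 ^ s" "2 ^ s \<le> 2 * \<bar>d\<bar> + 1" using power_of_two_between by blast
    define p :: nat where "p = 2 ^ s"
    have p: "d \<le> real p" "real p \<le> 2 * d + 1" "p \<ge> 1"
      using s d0 by (auto simp: p_def)
    \<comment> \<open>As \<open>d\<close> is at least \<open>C * ln 2\<close>, the additive 1 from
      rounding is absorbed into a multiple of \<open>d\<close>.\<close>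
    have "C * ln 2 \<le> C * ln (real n)" using C n2 by (intro mult_left_mono) auto
    also have "\<dots> \<le> d" using deg by (simp add: d_def)
    finally have "1 \<le> d / (C * ln 2)" using C by (simp add: field_simps)
    then have pd: "real p \<le> (2 + 1 / (C * ln 2)) * d" using p(2) by (simp add: algebra_simps)

    have trace_nonneg: "mat_trace_pow n (?X \<omega>) (2 * p) \<ge> 0" for \<omega>
      by (simp add: mat_trace_pow_double[OF sym_on_sym_mat] sum_nonneg)
    \<comment> \<open>A violating \<open>v\<close> has positive length, so the \<open>p\<close>-th
      power of its inequality can be divided by that of |v|^2.\<close>
    have "?Bad \<subseteq> {\<omega> \<in> space ?D. K ^ p \<le> mat_trace_pow n (?X \<omega>) (2 * p)}"
    proof clarsimp
      fix \<omega> v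
      let ?N = "\<Sum>i<n. (\<Sum>j<n. ?X \<omega> i j * v j)\<^sup>2" and ?S = "\<Sum>i<n. (v i)\<^sup>2"
      assume bad: "conc_const C * (real n * \<rho>) * ?S < ?N"
      have S: "?S > 0"
      proof (rule ccontr)
        assume "\<not> ?S > 0"
        then have S0: "?S = 0" by (intro antisym sum_nonneg) auto
        have "v i = 0" if "i < n" for i
          using S0 that by (subst (asm) sum_nonneg_eq_0_iff) auto
        then show False using bad by simp
      qed
      have "K ^ p * ?S ^ p \<le> ?N ^ p"
        using bad K S unfolding power_mult_distrib[symmetric]
        by (intro power_mono) (auto simp: K_def)
      also have "\<dots> \<le> mat_trace_pow n (?X \<omega>) (2 * p) * ?S ^ p"
        unfolding p_def by (rule norm_power_le_trace[OF sym_on_sym_mat])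
      finally show "K ^ p \<le> mat_trace_pow n (?X \<omega>) (2 * p)"
        using S by simp
    qed
    then have "measure_pmf.prob ?D ?Bad
        \<le> measure_pmf.prob ?D {\<omega> \<in> space ?D. K ^ p \<le> mat_trace_pow n (?X \<omega>) (2 * p)}"
      by (intro measure_pmf.finite_measure_mono) auto
    also have "\<dots> \<le> measure_pmf.expectation ?D (\<lambda>\<omega>. mat_trace_pow n (?X \<omega>) (2 * p)) / K ^ p"
      using K trace_nonneg
      by (intro integral_Markov_inequality_measure[where A = "{}"] integrable_Pi_pmf_bool) auto
    also have "\<dots> \<le> real n * (trace_const * real p) ^ p / K ^ p"
    proof (intro divide_right_mono expectation_trace_pow_le[OF \<rho>])
      show "real n * \<rho> \<le> real p" "1 \<le> p" using p by (simp_all add: d_def)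
      show "measure_pmf.expectation (bernoulli_pmf (q x)) (\<lambda>b. of_bool b - q x) = 0"
        if "x \<in> upper_pairs n" for x
        using q[OF that] \<rho> by (simp add: algebra_simps)
      show "\<bar>measure_pmf.expectation (bernoulli_pmf (q x)) (\<lambda>b. (of_bool b - q x) ^ k)\<bar> \<le> \<rho>"
        if "x \<in> upper_pairs n" "k \<ge> 2" for x k
        using q[OF that(1)] \<rho> bernoulli_centred_moment[of "q x" k] that(2) by force
    qed (use K in auto)
    also have "\<dots> = real n * (trace_const * real p / K) ^ p"
      by (simp add: power_divide)
    also have "\<dots> \<le> real n * exp (- (2 / C)) ^ p"
    proof (intro mult_left_mono power_mono)
      have "trace_const * real p \<le> trace_const * ((2 + 1 / (C * ln 2)) * d)"
        using trace_const_pos pd by (intro mult_left_mono) auto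
      also have "\<dots> = exp (- (2 / C)) * K"
        by (simp add: K_def conc_const_def d_def exp_minus)
      finally show "trace_const * real p / K \<le> exp (- (2 / C))"
        using K by (simp add: field_simps)
    qed (use trace_const_pos K in auto)
    also have "exp (- (2 / C)) ^ p = exp (- (2 * real p / C))"
      by (simp flip: exp_of_nat_mult)
    \<comment> \<open>The degree condition gives ln n \<le> p / C, so the exponential is at most
      n^(-2), which leaves 1 / n.\<close>
    also have "real n * exp (- (2 * real p / C)) \<le> real n * exp (- (2 * ln (real n)))"
    proof -
      have "C * ln (real n) \<le> real p" using deg p(1) by (simp add: d_def)
      then have "ln (real n) \<le> real p / C" using C by (simp add: field_simps)
      then show ?thesis by (intro mult_left_mono) auto
    qed
    also have "exp (- (2 * ln (real n))) = 1 / (real n)\<^sup>2"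
      using n2 by (simp add: exp_minus exp_double divide_inverse)
    also have "real n * (1 / (real n)\<^sup>2) = 1 / real n" using n2 by (simp add: power2_eq_square)
    finally show ?thesis by simp
  qed
qed


section \<open>Singular value thresholding of a block matrix\<close>

definition dotp :: "nat \<Rightarrow> (nat \<Rightarrow> real) \<Rightarrow> (nat \<Rightarrow> real) \<Rightarrow> real" where
  "dotp n x y = (\<Sum>i<n. x i * y i)"

definition orthonormal_on :: "nat \<Rightarrow> 'a set \<Rightarrow> ('a \<Rightarrow> nat \<Rightarrow> real) \<Rightarrow> bool" where
  "orthonormal_on n I y \<longleftrightarrow> finite I \<and> (\<forall>a\<in>I. \<forall>b\<in>I. dotp n (y a) (y b) = of_bool (a = b))"

lemma orthonormal_on_subset: "orthonormal_on n I y \<Longrightarrow> J \<subseteq> I \<Longrightarrow> orthonormal_on n J y"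
  unfolding orthonormal_on_def by (meson finite_subset subset_eq)

lemma dotp_commute: "dotp n x y = dotp n y x"
  by (simp add: dotp_def mult.commute)

lemma dotp_self: "dotp n x x = (\<Sum>i<n. (x i)\<^sup>2)"
  by (simp add: dotp_def power2_eq_square)

lemma dotp_sum: "dotp n x (\<lambda>i. \<Sum>l\<in>S. c l * f l i) = (\<Sum>l\<in>S. c l * dotp n x (f l))"
  unfolding dotp_def sum_distrib_left by (subst sum.swap) (simp add: mult.left_commute)

lemma dotp_diff: "dotp n x (\<lambda>i. f i - g i) = dotp n x f - dotp n x g"
  by (simp add: dotp_def algebra_simps sum_subtractf)

lemma orthonormal_sum_squares:
  assumes "orthonormal_on n I y"
  shows "(\<Sum>i<n. (\<Sum>a\<in>I. c a * y a i)\<^sup>2) = (\<Sum>a\<in>I. (c a)\<^sup>2)"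
proof -
  have "(\<Sum>i<n. (\<Sum>a\<in>I. c a * y a i)\<^sup>2) = (\<Sum>a\<in>I. c a * dotp n (\<lambda>i. \<Sum>a\<in>I. c a * y a i) (y a))"
    by (subst dotp_sum[symmetric]) (simp add: dotp_self)
  also have "\<dots> = (\<Sum>a\<in>I. c a * (\<Sum>b\<in>I. c b * of_bool (a = b)))"
    using assms by (intro sum.cong refl, subst dotp_commute) (simp add: dotp_sum orthonormal_on_def)
  also have "\<dots> = (\<Sum>a\<in>I. (c a)\<^sup>2)"
    using assms by (intro sum.cong refl)
      (auto simp: orthonormal_on_def of_bool_def if_distrib[of "\<lambda>x. _ * x"] power2_eq_square cong: if_cong)
  finally show ?thesis .
qed

text \<open>This is (1 - Q) x, where Q is the orthogonal projection onto the span of an orthonormal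
  family.\<close>

definition proj_resid :: "nat \<Rightarrow> 'a set \<Rightarrow> ('a \<Rightarrow> nat \<Rightarrow> real) \<Rightarrow> (nat \<Rightarrow> real) \<Rightarrow> nat \<Rightarrow> real" where
  "proj_resid n I y x i = x i - (\<Sum>a\<in>I. dotp n (y a) x * y a i)"

lemma proj_resid_sum:
  "proj_resid n I y (\<lambda>i. \<Sum>l\<in>S. c l * f l i) i = (\<Sum>l\<in>S. c l * proj_resid n I y (f l) i)"
proof -
  have "(\<Sum>a\<in>I. dotp n (y a) (\<lambda>i. \<Sum>l\<in>S. c l * f l i) * y a i)
      = (\<Sum>a\<in>I. \<Sum>l\<in>S. c l * (dotp n (y a) (f l) * y a i))"
    by (simp add: dotp_sum sum_distrib_right mult.assoc)
  also have "\<dots> = (\<Sum>l\<in>S. c l * (\<Sum>a\<in>I. dotp n (y a) (f l) * y a i))"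
    by (subst sum.swap) (simp add: sum_distrib_left)
  finally show ?thesis
    by (simp add: proj_resid_def sum_subtractf right_diff_distrib)
qed

lemma proj_resid_diff:
  "proj_resid n I y (\<lambda>i. f i - g i) i = proj_resid n I y f i - proj_resid n I y g i"
  by (simp add: proj_resid_def dotp_diff left_diff_distrib sum_subtractf)

lemma proj_resid_norm:
  assumes "orthonormal_on n I y"
  shows "(\<Sum>i<n. (proj_resid n I y x i)\<^sup>2) = dotp n x x - (\<Sum>a\<in>I. (dotp n (y a) x)\<^sup>2)"
proof -
  let ?q = "\<lambda>i. \<Sum>a\<in>I. dotp n (y a) x * y a i"
  have "(\<Sum>i<n. (proj_resid n I y x i)\<^sup>2) = dotp n x x - 2 * dotp n x ?q + (\<Sum>i<n. (?q i)\<^sup>2)"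
    by (simp add: proj_resid_def power2_diff sum.distrib sum_subtractf dotp_self)
       (simp add: dotp_def sum_distrib_left mult.assoc)
  also have "dotp n x ?q = (\<Sum>a\<in>I. (dotp n (y a) x)\<^sup>2)"
    by (simp add: dotp_sum power2_eq_square dotp_commute[of n x])
  also have "(\<Sum>i<n. (?q i)\<^sup>2) = (\<Sum>a\<in>I. (dotp n (y a) x)\<^sup>2)"
    by (rule orthonormal_sum_squares[OF assms])
  finally show ?thesis by simp
qed

lemma bessel:
  assumes "orthonormal_on n I y"
  shows "(\<Sum>a\<in>I. (dotp n (y a) x)\<^sup>2) \<le> dotp n x x"
proof -
  have "(\<Sum>i<n. (proj_resid n I y x i)\<^sup>2) \<ge> 0" by (intro sum_nonneg) auto
  then show ?thesis using proj_resid_norm[OF assms, of x] by simp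
qed

text \<open>\<open>K\<close> bounds the squared norm of A - P, and \<open>\<theta>\<close> is the
  margin of the squared threshold over it. Each column of the error is split by Pythagoras into its
  component in the range of Q and the orthogonal one.\<close>

lemma singular_value_threshold_error:
  fixes A P :: "nat \<Rightarrow> nat \<Rightarrow> real" and z :: "'a \<Rightarrow> nat \<Rightarrow> real"
  assumes u: "orthonormal_on n {..<n} u" and v: "orthonormal_on n {..<n} v"
    and A: "\<And>i j. i < n \<Longrightarrow> j < n \<Longrightarrow> A i j = (\<Sum>l<n. s l * u l i * v l j)"
    and s: "\<And>l. l < n \<Longrightarrow> 0 \<le> s l"
    and z: "orthonormal_on n B z"
    and P: "\<And>i j. i < n \<Longrightarrow> j < n \<Longrightarrow> proj_resid n B z (\<lambda>i. P i j) i = 0"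
    and sym: "sym_on n (\<lambda>i j. A i j - P i j)"
    and K: "\<And>x. (\<Sum>i<n. (\<Sum>j<n. (A i j - P i j) * x j)\<^sup>2) \<le> K * (\<Sum>i<n. (x i)\<^sup>2)"
    and K0: "K > 0" and \<theta>: "\<theta> > 1" and \<tau>: "\<tau> > 0" "\<tau>\<^sup>2 \<ge> \<theta> * K"
  defines "S \<equiv> {l. l < n \<and> s l \<ge> \<tau>}"
  shows "(\<Sum>i<n. \<Sum>j<n. ((\<Sum>l\<in>S. s l * u l i * v l j) - P i j)\<^sup>2)
       \<le> real (card B) * (2 * \<tau>\<^sup>2 + 2 * K + \<theta> / (\<theta> - 1) * K)"
proof -
  let ?r = "proj_resid n B z"
  have SS: "S \<subseteq> {..<n}" and finS: "finite S"
    by (auto simp: S_def)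
  have uS: "orthonormal_on n S u" and vS: "orthonormal_on n S v"
    using orthonormal_on_subset SS u v by blast+
  have finB: "finite B" using z by (simp add: orthonormal_on_def)
  have vv: "dotp n (v l) (v m) = of_bool (l = m)" if "l < n" "m < n" for l m
    using v that by (simp add: orthonormal_on_def)
  have uu: "dotp n (u l) (u l) = 1" if "l < n" for l
    using u that by (simp add: orthonormal_on_def)
  define R where "R l = (\<Sum>i<n. (?r (u l) i)\<^sup>2)" for l
  have R: "R l = 1 - (\<Sum>a\<in>B. (dotp n (z a) (u l))\<^sup>2)" if "l < n" for l
    using proj_resid_norm[OF z, of "u l"] that by (simp add: R_def uu)
  have R_nonneg: "R l \<ge> 0" for l by (auto simp: R_def intro!: sum_nonneg)

  \<comment> \<open>Apply 1 - Q to (A - P) v = s u - P v; the columns of \<open>P\<close> are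
    annihilated.\<close>
  have sR: "(s l)\<^sup>2 * R l \<le> K" if l: "l < n" for l
  proof -
    define y where "y i = (\<Sum>j<n. (A i j - P i j) * v l j)" for i
    have Av: "(\<Sum>j<n. A i j * v l j) = s l * u l i" if "i < n" for i
    proof -
      have "(\<Sum>j<n. A i j * v l j) = dotp n (v l) (\<lambda>j. \<Sum>m<n. (s m * u m i) * v m j)"
        using that by (simp add: dotp_def A mult.commute)
      also have "\<dots> = s l * u l i"
        using l by (simp add: dotp_sum vv of_bool_def if_distrib[of "\<lambda>x. _ * x"] cong: if_cong)
      finally show ?thesis .
    qed
    have dotp_cong: "dotp n x f = dotp n x g" if "\<And>i. i < n \<Longrightarrow> f i = g i" for x f g
      using that by (simp add: dotp_def)
    have yeq: "y i = s l * u l i - (\<Sum>j<n. v l j * P i j)" if "i < n" for i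
      using Av[OF that] by (simp add: y_def left_diff_distrib sum_subtractf) (simp add: mult.commute)
    have "?r y i = s l * ?r (u l) i" if i: "i < n" for i
    proof -
      have "?r y i = ?r (\<lambda>i. s l * u l i - (\<Sum>j<n. v l j * P i j)) i"
        unfolding proj_resid_def using yeq i dotp_cong[of y "\<lambda>i. s l * u l i - (\<Sum>j<n. v l j * P i j)"]
        by simp
      also have "\<dots> = ?r (\<lambda>i. \<Sum>m\<in>{l}. s m * u m i) i - ?r (\<lambda>i. \<Sum>j<n. v l j * P i j) i"
        by (simp add: proj_resid_diff)
      also have "\<dots> = s l * ?r (u l) i - (\<Sum>j<n. v l j * ?r (\<lambda>i. P i j) i)"
        by (simp only: proj_resid_sum) simp
      finally show ?thesis using P i by simp
    qed
    then have "(s l)\<^sup>2 * R l = (\<Sum>i<n. (?r y i)\<^sup>2)"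
      by (simp add: R_def power_mult_distrib sum_distrib_left)
    also have "\<dots> \<le> dotp n y y"
      using proj_resid_norm[OF z, of y] by (simp add: sum_nonneg)
    also have "\<dots> \<le> K * (\<Sum>i<n. (v l i)\<^sup>2)"
      unfolding dotp_self y_def by (rule K)
    also have "\<dots> = K" using vv[OF l l] by (simp add: dotp_self)
    finally show ?thesis .
  qed

  \<comment> \<open>Each retained left singular vector has at least the share 1 - 1 / \<theta> of
    its squared length in the range of Q. By Bessel for each \<open>z a\<close>, these shares add up
    to at most \<open>card B\<close>.\<close>
  have cardS: "real (card S) \<le> \<theta> / (\<theta> - 1) * real (card B)"
  proof -
    have "1 - 1 / \<theta> \<le> (\<Sum>a\<in>B. (dotp n (z a) (u l))\<^sup>2)" if l: "l \<in> S" for l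
    proof -
      have "\<theta> * K * R l \<le> (s l)\<^sup>2 * R l"
        using l \<tau> R_nonneg
        by (intro mult_right_mono order_trans[OF \<tau>(2)] power_mono) (auto simp: S_def)
      also have "\<dots> \<le> K" using l sR by (simp add: S_def)
      finally have "\<theta> * R l \<le> 1" using K0 by (simp add: mult.assoc mult.left_commute)
      then have "R l \<le> 1 / \<theta>" using \<theta> by (simp add: field_simps)
      then show ?thesis using R[of l] l by (simp add: S_def)
    qed
    then have "(\<Sum>l\<in>S. 1 - 1 / \<theta>) \<le> (\<Sum>l\<in>S. \<Sum>a\<in>B. (dotp n (z a) (u l))\<^sup>2)"
      by (intro sum_mono)
    also have "\<dots> = (\<Sum>a\<in>B. \<Sum>l\<in>S. (dotp n (u l) (z a))\<^sup>2)"
      by (subst sum.swap) (simp add: dotp_commute)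
    also have "\<dots> \<le> (\<Sum>a\<in>B. 1)"
      using z by (intro sum_mono order_trans[OF bessel[OF uS]]) (simp add: orthonormal_on_def)
    finally show ?thesis using \<theta> by (simp add: field_simps)
  qed

  define W where "W i j = (\<Sum>l\<in>S. s l * u l i * v l j) - P i j" for i j
  \<comment> \<open>W is A - P minus the discarded part of A, whose singular values are below
    \<open>\<tau>\<close>. Against the unit vector \<open>z a\<close> the squared lengths are at
    most \<open>K\<close> and \<open>\<tau>^2\<close>.\<close>
  have Wz: "(\<Sum>j<n. (dotp n (z a) (\<lambda>i. W i j))\<^sup>2) \<le> 2 * \<tau>\<^sup>2 + 2 * K" if a: "a \<in> B" for a
  proof -
    let ?S' = "{..<n} - S"
    let ?D = "\<lambda>j. \<Sum>i<n. (A j i - P j i) * z a i"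
    let ?T = "\<lambda>j. \<Sum>l\<in>?S'. (s l * dotp n (u l) (z a)) * v l j"
    have zz: "dotp n (z a) (z a) = 1" using z a by (simp add: orthonormal_on_def)
    have W_eq: "W i j = (A i j - P i j) - (\<Sum>l\<in>?S'. (s l * v l j) * u l i)" if "i < n" "j < n" for i j
    proof -
      have "A i j = (\<Sum>l\<in>?S'. s l * u l i * v l j) + (\<Sum>l\<in>S. s l * u l i * v l j)"
        using A[OF that] SS by (simp add: sum.subset_diff)
      then show ?thesis by (simp add: W_def mult_ac)
    qed
    have eq: "dotp n (z a) (\<lambda>i. W i j) = ?D j - ?T j" if j: "j < n" for j
    proof -
      have "dotp n (z a) (\<lambda>i. W i j)
          = dotp n (z a) (\<lambda>i. (A i j - P i j) - (\<Sum>l\<in>?S'. (s l * v l j) * u l i))"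
        unfolding dotp_def using W_eq j by (intro sum.cong) auto
      also have "\<dots> = dotp n (z a) (\<lambda>i. A i j - P i j) - ?T j"
        unfolding dotp_diff dotp_sum by (simp add: dotp_commute mult_ac)
      also have "dotp n (z a) (\<lambda>i. A i j - P i j) = ?D j"
        using sym j by (auto simp: dotp_def sym_on_def mult.commute intro!: sum.cong)
      finally show ?thesis .
    qed
    have "(\<Sum>j<n. (dotp n (z a) (\<lambda>i. W i j))\<^sup>2) \<le> (\<Sum>j<n. 2 * (?T j)\<^sup>2 + 2 * (?D j)\<^sup>2)"
    proof (intro sum_mono)
      fix j assume "j \<in> {..<n}"
      then have "(dotp n (z a) (\<lambda>i. W i j))\<^sup>2 = (?D j - ?T j)\<^sup>2" using eq by simp
      also have "\<dots> \<le> 2 * (?T j)\<^sup>2 + 2 * (?D j)\<^sup>2"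
        using zero_le_power2[of "?D j + ?T j"] unfolding power2_sum power2_diff by linarith
      finally show "(dotp n (z a) (\<lambda>i. W i j))\<^sup>2 \<le> 2 * (?T j)\<^sup>2 + 2 * (?D j)\<^sup>2" .
    qed
    also have "\<dots> = 2 * (\<Sum>j<n. (?T j)\<^sup>2) + 2 * (\<Sum>j<n. (?D j)\<^sup>2)"
      by (simp add: sum.distrib sum_distrib_left)
    also have "(\<Sum>j<n. (?D j)\<^sup>2) \<le> K"
      using K[of "z a"] zz by (simp add: dotp_self)
    also have "(\<Sum>j<n. (?T j)\<^sup>2) = (\<Sum>l\<in>?S'. (s l * dotp n (u l) (z a))\<^sup>2)"
      by (rule orthonormal_sum_squares[OF orthonormal_on_subset[OF v]]) auto
    also have "\<dots> \<le> (\<Sum>l\<in>?S'. \<tau>\<^sup>2 * (dotp n (u l) (z a))\<^sup>2)"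
      using s by (intro sum_mono) (auto simp: S_def power_mult_distrib intro!: mult_right_mono power_mono)
    also have "\<dots> \<le> \<tau>\<^sup>2 * 1"
      unfolding sum_distrib_left[symmetric]
      using bessel[OF orthonormal_on_subset[OF u], of ?S' "z a"] zz by (intro mult_left_mono) auto
    finally show ?thesis by simp
  qed

  \<comment> \<open>(1 - Q) W is the sum of s ((1 - Q) u) v^T over \<open>S\<close>; orthonormality
    of the \<open>v l\<close> separates the terms, each at most \<open>K\<close> by
    \<open>sR\<close>.\<close>
  have Wr: "(\<Sum>j<n. \<Sum>i<n. (?r (\<lambda>i. W i j) i)\<^sup>2) \<le> real (card S) * K"
  proof -
    have "?r (\<lambda>i. W i j) i = (\<Sum>l\<in>S. (s l * ?r (u l) i) * v l j)" if "i < n" "j < n" for i j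
    proof -
      have "?r (\<lambda>i. W i j) i = ?r (\<lambda>i. \<Sum>l\<in>S. (s l * v l j) * u l i) i - ?r (\<lambda>i. P i j) i"
        unfolding proj_resid_diff[symmetric] W_def by (simp add: mult_ac)
      then show ?thesis unfolding proj_resid_sum using P that by (simp add: mult_ac)
    qed
    then have "(\<Sum>j<n. \<Sum>i<n. (?r (\<lambda>i. W i j) i)\<^sup>2)
        = (\<Sum>j<n. \<Sum>i<n. (\<Sum>l\<in>S. (s l * ?r (u l) i) * v l j)\<^sup>2)"
      by simp
    also have "\<dots> = (\<Sum>i<n. \<Sum>l\<in>S. (s l * ?r (u l) i)\<^sup>2)"
      by (subst sum.swap) (simp add: orthonormal_sum_squares[OF vS])
    also have "\<dots> = (\<Sum>l\<in>S. (s l)\<^sup>2 * R l)"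
      by (subst sum.swap) (simp add: R_def power_mult_distrib sum_distrib_left)
    also have "\<dots> \<le> (\<Sum>l\<in>S. K)"
      using sR by (intro sum_mono) (auto simp: S_def)
    finally show ?thesis by simp
  qed

  have "(\<Sum>i<n. \<Sum>j<n. (W i j)\<^sup>2) = (\<Sum>j<n. dotp n (\<lambda>i. W i j) (\<lambda>i. W i j))"
    unfolding dotp_self by (rule sum.swap)
  also have "\<dots> = (\<Sum>j<n. (\<Sum>i<n. (?r (\<lambda>i. W i j) i)\<^sup>2) + (\<Sum>a\<in>B. (dotp n (z a) (\<lambda>i. W i j))\<^sup>2))"
    by (simp add: proj_resid_norm[OF z])
  also have "\<dots> = (\<Sum>j<n. \<Sum>i<n. (?r (\<lambda>i. W i j) i)\<^sup>2) + (\<Sum>a\<in>B. \<Sum>j<n. (dotp n (z a) (\<lambda>i. W i j))\<^sup>2)"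
    unfolding sum.distrib by (subst (2) sum.swap) simp
  also have "\<dots> \<le> real (card S) * K + (\<Sum>a\<in>B. 2 * \<tau>\<^sup>2 + 2 * K)"
    using Wr Wz by (intro add_mono sum_mono)
  also have "\<dots> \<le> (\<theta> / (\<theta> - 1) * real (card B)) * K + real (card B) * (2 * \<tau>\<^sup>2 + 2 * K)"
    using cardS K0 by (intro add_mono mult_right_mono) auto
  finally show ?thesis by (simp add: W_def algebra_simps)
qed

section \<open>Clipping, and the span of the block indicators\<close>

lemma clip_contract:
  fixes y t :: real
  assumes "0 \<le> y" "y \<le> 1"
  shows "(y - min 1 (max 0 t))\<^sup>2 \<le> (y - t)\<^sup>2"
  using assms by (subst abs_le_square_iff[symmetric]) (auto simp: min_def max_def abs_if)

text \<open>Both matrices vanish on the diagonal, so the filled-in diagonal on the right only adds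
  error. The estimate mirrors its upper triangle, where each error counts twice; this gives the
  factor 2.\<close>

lemma frobenius_clip_le:
  assumes x: "\<And>i. i < n \<Longrightarrow> x i \<in> {1..k}"
    and f: "\<And>a b. a \<in> {1..k} \<Longrightarrow> b \<in> {1..k} \<Longrightarrow> f a b \<in> {0..1} \<and> f a b = f b a"
    and T: "T \<in> carrier_mat n n" and \<rho>: "\<rho> > 0"
  shows "(frobenius_norm (edge_prob_mat n f x - clip_mat n ((1 / \<rho>) \<cdot>\<^sub>m T)))\<^sup>2
       \<le> 2 / \<rho>\<^sup>2 * (\<Sum>i<n. \<Sum>j<n. (T $$ (i, j) - \<rho> * f (x i) (x j))\<^sup>2)"
proof -
  define G where "G = (\<lambda>(i, j). (T $$ (i, j) / \<rho> - f (x i) (x j))\<^sup>2)"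
  let ?B = "clip_mat n ((1 / \<rho>) \<cdot>\<^sub>m T)" and ?M = "edge_prob_mat n f x"
  have "(frobenius_norm (?M - ?B))\<^sup>2 = (\<Sum>i<n. \<Sum>j<n. ((?M - ?B) $$ (i, j))\<^sup>2)"
    by (simp add: frobenius_norm_def sum_nonneg clip_mat_def edge_prob_mat_def)
  also have "\<dots> \<le> (\<Sum>i<n. \<Sum>j<n. if i = j then 0 else G (edge i j))"
  proof (intro sum_mono)
    fix i j assume ij: "i \<in> {..<n}" "j \<in> {..<n}"
    show "((?M - ?B) $$ (i, j))\<^sup>2 \<le> (if i = j then 0 else G (edge i j))"
    proof (cases "i = j")
      case True
      then show ?thesis using ij by (simp add: clip_mat_def edge_prob_mat_def)
    next
      case False
      let ?t = "T $$ (min i j, max i j) / \<rho>"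
      have fij: "f (x i) (x j) \<in> {0..1}" "f (x (min i j)) (x (max i j)) = f (x i) (x j)"
        using f[OF x x, of i j] ij by (auto simp: min_def max_def)
      have "(?M - ?B) $$ (i, j) = f (x i) (x j) - min 1 (max 0 ?t)"
        using ij False T by (simp add: clip_mat_def edge_prob_mat_def)
      then have "((?M - ?B) $$ (i, j))\<^sup>2 \<le> (f (x i) (x j) - ?t)\<^sup>2"
        using clip_contract fij by simp
      also have "\<dots> = G (edge i j)"
        unfolding G_def edge_def by (simp add: fij(2) power2_commute)
      finally show ?thesis using False by simp
    qed
  qed
  also have "\<dots> = (\<Sum>(i, j)\<in>upper_pairs n. G (edge i j) + G (edge j i))"
    by (rule sum_offdiag)
  also have "\<dots> \<le> (\<Sum>(i, j)\<in>upper_pairs n. 2 * G (i, j) + 2 * G (j, i))"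
    by (intro sum_mono) (auto simp: upper_pairs_def edge_def min_def max_def G_def)
  also have "\<dots> = (\<Sum>i<n. \<Sum>j<n. if i = j then 0 else 2 * G (i, j))"
    by (rule sum_offdiag[symmetric])
  also have "\<dots> \<le> (\<Sum>i<n. \<Sum>j<n. 2 * G (i, j))"
    by (intro sum_mono) (auto simp: G_def)
  also have "\<dots> = (\<Sum>i<n. \<Sum>j<n. 2 / \<rho>\<^sup>2 * (T $$ (i, j) - \<rho> * f (x i) (x j))\<^sup>2)"
  proof (intro sum.cong refl)
    fix i j
    have "T $$ (i, j) / \<rho> - f (x i) (x j) = (T $$ (i, j) - \<rho> * f (x i) (x j)) / \<rho>"
      using \<rho> by (simp add: field_simps)
    then show "2 * G (i, j) = 2 / \<rho>\<^sup>2 * (T $$ (i, j) - \<rho> * f (x i) (x j))\<^sup>2"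
      by (simp add: G_def power_divide)
  qed
  finally show ?thesis by (simp add: sum_distrib_left)
qed

text \<open>Only occupied blocks are indexed, so no normaliser vanishes. A vector constant on
  blocks, such as a column of the filled-in \<rho> M, lies in the span of the indicators.\<close>

lemma block_indicators:
  fixes x :: "nat \<Rightarrow> nat" and n :: nat
  defines "N \<equiv> \<lambda>a. real (card {i. i < n \<and> x i = a})"
  defines "z \<equiv> \<lambda>a i. of_bool (x i = a) / sqrt (N a)"
  shows "orthonormal_on n (x ` {..<n}) z"
    and "i < n \<Longrightarrow> proj_resid n (x ` {..<n}) z (\<lambda>i. h (x i)) i = 0"
proof -
  have N: "N a > 0" if "a \<in> x ` {..<n}" for a
    using that by (auto simp: N_def card_gt_0_iff)
  have cnt: "(\<Sum>i<n. of_bool (x i = a)) = N a" for a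
  proof -
    have "{..<n} \<inter> {i. x i = a} = {i. i < n \<and> x i = a}" by auto
    then show ?thesis by (simp add: N_def of_bool_def sum.If_cases)
  qed
  show "orthonormal_on n (x ` {..<n}) z"
    unfolding orthonormal_on_def
  proof (intro conjI ballI)
    fix a b assume ab: "a \<in> x ` {..<n}" "b \<in> x ` {..<n}"
    have "dotp n (z a) (z b) = (\<Sum>i<n. of_bool (a = b) * (of_bool (x i = a) / N a))"
      unfolding dotp_def z_def using N[OF ab(1)]
      by (intro sum.cong refl) (auto simp flip: real_sqrt_mult)
    also have "\<dots> = of_bool (a = b)"
      using N[OF ab(1)] by (simp add: cnt flip: sum_distrib_left sum_divide_distrib)
    finally show "dotp n (z a) (z b) = of_bool (a = b)" .
  qed simp
  assume i: "i < n"
  have dp: "dotp n (z a) (\<lambda>i. h (x i)) = sqrt (N a) * h a" if "a \<in> x ` {..<n}" for a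
  proof -
    have "dotp n (z a) (\<lambda>i. h (x i)) = (\<Sum>i<n. h a / sqrt (N a) * of_bool (x i = a))"
      unfolding dotp_def z_def by (intro sum.cong) auto
    also have "\<dots> = h a / sqrt (N a) * N a" by (simp only: cnt flip: sum_distrib_left)
    also have "\<dots> = sqrt (N a) * h a" using N[OF that] by (simp add: real_div_sqrt field_simps)
    finally show ?thesis .
  qed
  have "(\<Sum>a\<in>x ` {..<n}. dotp n (z a) (\<lambda>i. h (x i)) * z a i) = (\<Sum>a\<in>x ` {..<n}. if a = x i then h (x i) else 0)"
    using dp N by (intro sum.cong refl) (force simp: z_def)
  also have "\<dots> = h (x i)" using i by simp
  finally show "proj_resid n (x ` {..<n}) z (\<lambda>i. h (x i)) i = 0"
    by (simp add: proj_resid_def)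
qed


section \<open>The mean squared error\<close>

lemma edge_prob_mat_index:
  "i < n \<Longrightarrow> j < n \<Longrightarrow> edge_prob_mat n f x $$ (i, j) = (if i = j then 0 else f (x i) (x j))"
  by (simp add: edge_prob_mat_def)

lemma adjacency_mat_index:
  "i < n \<Longrightarrow> j < n \<Longrightarrow> adjacency_mat n e $$ (i, j) = (if i = j then 0 else of_bool (e (edge i j)))"
  by (simp add: adjacency_mat_def edge_def)

text \<open>The event that the squared operator norm of A - \<rho> M exceeds \<open>K\<close>,
  expressed through test vectors.\<close>

definition large_noise :: "nat \<Rightarrow> real \<Rightarrow> real \<Rightarrow> (real mat \<times> real mat) set" where
  "large_noise n \<rho> K = {(M, A). \<exists>v. (\<Sum>i<n. (\<Sum>j<n. (A $$ (i, j) - \<rho> * M $$ (i, j)) * v j)\<^sup>2)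
                                  > K * (\<Sum>i<n. (v i)\<^sup>2)}"

lemma usvt_error_bound:
  assumes x: "\<And>i. i < n \<Longrightarrow> x i \<in> {1..k}"
    and f: "\<And>a b. a \<in> {1..k} \<Longrightarrow> b \<in> {1..k} \<Longrightarrow> f a b \<in> {0..1} \<and> f a b = f b a"
    and n: "n \<ge> 1" and \<rho>: "0 < \<rho>" "\<rho> \<le> 1" and K: "K > 0" and \<theta>: "\<theta> > 1"
    and \<tau>: "\<tau> > 0" "\<tau>\<^sup>2 = \<theta> * ((2 * K + 2) * (real n * \<rho>))"
    and small: "(edge_prob_mat n f x, adjacency_mat n e) \<notin> large_noise n \<rho> (K * (real n * \<rho>))"
    and out: "usvt_output n (adjacency_mat n e) \<rho> \<tau> B"
  shows "(frobenius_norm (edge_prob_mat n f x - B))\<^sup>2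
       \<le> 2 * (2 * \<theta> + 2 + \<theta> / (\<theta> - 1)) * (2 * K + 2) * (real n * real k / \<rho>)"
proof -
  let ?A = "adjacency_mat n e" and ?M = "edge_prob_mat n f x"
  define d where "d = real n * \<rho>"
  have d: "d > 0" using n \<rho> by (simp add: d_def)
  define P where "P i j = \<rho> * f (x i) (x j)" for i j
  define N where "N a = real (card {i. i < n \<and> x i = a})" for a
  define z where "z a i = of_bool (x i = a) / sqrt (N a)" for a i
  \<comment> \<open>Filling in the diagonal perturbs the noise by entries of square at most \<rho>^2
    \<le> d. With (a - b)^2 \<le> 2 a^2 + 2 b^2 the noise accounts for 2 K d and the diagonal for 2
    d.\<close>
  define L where "L = (2 * K + 2) * d"
  have L: "L > 0" using K d by (simp add: L_def)
  obtain s u v where svd: "is_svd n ?A s u v"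
    and B: "B = clip_mat n ((1 / \<rho>) \<cdot>\<^sub>m svd_threshold n \<tau> s u v)"
    using out by (auto simp: usvt_output_def)
  let ?T = "svd_threshold n \<tau> s u v"
  have T: "?T \<in> carrier_mat n n" by (simp add: svd_threshold_def)
  have dot: "dotp n (\<lambda>i. a $ i) (\<lambda>i. b $ i) = a \<bullet> b" if "b \<in> carrier_vec n" for a b :: "real Matrix.vec"
    using that by (simp add: dotp_def scalar_prod_def lessThan_atLeast0)
  have ortho: "orthonormal_on n {..<n} (\<lambda>l i. u l $ i)" "orthonormal_on n {..<n} (\<lambda>l i. v l $ i)"
    using svd by (simp_all add: orthonormal_on_def dot is_svd_def)
  have noise: "(\<Sum>i<n. (\<Sum>j<n. (?A $$ (i, j) - P i j) * y j)\<^sup>2) \<le> L * (\<Sum>i<n. (y i)\<^sup>2)" for y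
  proof -
    let ?w = "\<lambda>i. \<Sum>j<n. (?A $$ (i, j) - \<rho> * ?M $$ (i, j)) * y j"
    have "(\<Sum>j<n. (?A $$ (i, j) - P i j) * y j) = ?w i - \<rho> * f (x i) (x i) * y i" if i: "i < n" for i
    proof -
      have "(\<Sum>j<n. (?A $$ (i, j) - P i j) * y j)
          = (\<Sum>j<n. (?A $$ (i, j) - \<rho> * ?M $$ (i, j)) * y j - (if j = i then \<rho> * f (x i) (x i) * y i else 0))"
        using i by (intro sum.cong refl) (auto simp: edge_prob_mat_index P_def algebra_simps)
      then show ?thesis using i by (simp add: sum_subtractf)
    qed
    moreover have "(?w i - \<rho> * f (x i) (x i) * y i)\<^sup>2 \<le> 2 * (?w i)\<^sup>2 + 2 * d * (y i)\<^sup>2" if i: "i < n" for i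
    proof -
      have fi: "0 \<le> f (x i) (x i)" "f (x i) (x i) \<le> 1" using f[OF x[OF i] x[OF i]] by auto
      have "(\<rho> * f (x i) (x i))\<^sup>2 \<le> \<rho>\<^sup>2"
        using fi \<rho> by (intro power_mono mult_left_le) auto
      also have "\<rho>\<^sup>2 \<le> \<rho>" using \<rho> by (simp add: power2_eq_square mult_left_le)
      also have "\<rho> \<le> d" using n \<rho> by (simp add: d_def)
      finally have "(\<rho> * f (x i) (x i) * y i)\<^sup>2 \<le> d * (y i)\<^sup>2"
        unfolding power_mult_distrib[of "\<rho> * f (x i) (x i)"] by (intro mult_right_mono) auto
      moreover have "(a - b)\<^sup>2 \<le> 2 * a\<^sup>2 + 2 * b\<^sup>2" for a b :: real
        using zero_le_power2[of "a + b"] unfolding power2_sum power2_diff by linarith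
      from this[of "?w i" "\<rho> * f (x i) (x i) * y i"]
      have "(?w i - \<rho> * f (x i) (x i) * y i)\<^sup>2 \<le> 2 * (?w i)\<^sup>2 + 2 * (\<rho> * f (x i) (x i) * y i)\<^sup>2" .
      ultimately show ?thesis by linarith
    qed
    ultimately have "(\<Sum>i<n. (\<Sum>j<n. (?A $$ (i, j) - P i j) * y j)\<^sup>2)
        \<le> (\<Sum>i<n. 2 * (?w i)\<^sup>2 + 2 * d * (y i)\<^sup>2)"
      by (intro sum_mono) simp
    also have "\<dots> = 2 * (\<Sum>i<n. (?w i)\<^sup>2) + 2 * d * (\<Sum>i<n. (y i)\<^sup>2)"
      by (simp add: sum.distrib sum_distrib_left)
    also have "(\<Sum>i<n. (?w i)\<^sup>2) \<le> K * d * (\<Sum>i<n. (y i)\<^sup>2)"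
      using small unfolding large_noise_def d_def by (auto simp: not_less)
    finally show ?thesis by (simp add: L_def algebra_simps)
  qed
  have "(\<Sum>i<n. \<Sum>j<n. ((\<Sum>l | l < n \<and> s l \<ge> \<tau>. s l * u l $ i * v l $ j) - P i j)\<^sup>2)
      \<le> real (card (x ` {..<n})) * (2 * \<tau>\<^sup>2 + 2 * L + \<theta> / (\<theta> - 1) * L)"
  proof (rule singular_value_threshold_error[where A = "\<lambda>i j. ?A $$ (i, j)" and z = z, OF ortho])
    show "?A $$ (i, j) = (\<Sum>l<n. s l * u l $ i * v l $ j)" if "i < n" "j < n" for i j
    proof -
      have "?A = mat n n (\<lambda>(i, j). \<Sum>l<n. s l * u l $ i * v l $ j)"
        using svd by (simp add: is_svd_def)
      then have "?A $$ (i, j) = mat n n (\<lambda>(i, j). \<Sum>l<n. s l * u l $ i * v l $ j) $$ (i, j)"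
        by (rule arg_cong)
      then show ?thesis using that by simp
    qed
    show "0 \<le> s l" if "l < n" for l using svd that by (simp add: is_svd_def)
    show "orthonormal_on n (x ` {..<n}) z"
      using block_indicators(1)[of n x] by (simp add: z_def[abs_def] N_def)
    show "proj_resid n (x ` {..<n}) z (\<lambda>i. P i j) i = 0" if "i < n" "j < n" for i j
      using block_indicators(2)[OF that(1), of x "\<lambda>a. \<rho> * f a (x j)"]
      by (simp add: z_def[abs_def] N_def P_def)
    show "sym_on n (\<lambda>i j. ?A $$ (i, j) - P i j)"
      using f[OF x x] by (auto simp: sym_on_def adjacency_mat_index P_def edge_def min.commute max.commute)
  qed (use noise L \<theta> \<tau> in \<open>auto simp: L_def d_def\<close>)
  also have "\<dots> \<le> real k * (2 * \<tau>\<^sup>2 + 2 * L + \<theta> / (\<theta> - 1) * L)"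
  proof (intro mult_right_mono)
    have "card (x ` {..<n}) \<le> card {1..k}" using x by (intro card_mono) auto
    then show "real (card (x ` {..<n})) \<le> real k" by simp
  qed (use L \<theta> in auto)
  also have "\<dots> = real k * ((2 * \<theta> + 2 + \<theta> / (\<theta> - 1)) * (2 * K + 2) * (real n * \<rho>))"
    unfolding \<tau> L_def d_def by (simp add: algebra_simps)
  finally have err: "(\<Sum>i<n. \<Sum>j<n. (?T $$ (i, j) - \<rho> * f (x i) (x j))\<^sup>2)
      \<le> real k * ((2 * \<theta> + 2 + \<theta> / (\<theta> - 1)) * (2 * K + 2) * (real n * \<rho>))"
    by (simp add: svd_threshold_def P_def)
  have "(frobenius_norm (?M - B))\<^sup>2 \<le> 2 / \<rho>\<^sup>2 * (\<Sum>i<n. \<Sum>j<n. (?T $$ (i, j) - \<rho> * f (x i) (x j))\<^sup>2)"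
    unfolding B by (rule frobenius_clip_le[OF x f T \<rho>(1)])
  also have "\<dots> \<le> 2 / \<rho>\<^sup>2 * (real k * ((2 * \<theta> + 2 + \<theta> / (\<theta> - 1)) * (2 * K + 2) * (real n * \<rho>)))"
    by (intro mult_left_mono err) auto
  also have "\<dots> = 2 * (2 * \<theta> + 2 + \<theta> / (\<theta> - 1)) * (2 * K + 2) * (real n * real k / \<rho>)"
    using \<rho> by (simp add: power2_eq_square)
  finally show ?thesis .
qed

lemma frobenius_error_le_square:
  assumes x: "\<And>i. i < n \<Longrightarrow> x i \<in> {1..k}"
    and f: "\<And>a b. a \<in> {1..k} \<Longrightarrow> b \<in> {1..k} \<Longrightarrow> f a b \<in> {0..1}"
    and out: "usvt_output n A \<rho> \<tau> B"
  shows "(frobenius_norm (edge_prob_mat n f x - B))\<^sup>2 \<le> (real n)\<^sup>2"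
proof -
  let ?M = "edge_prob_mat n f x"
  obtain R where B: "B = clip_mat n R" using out by (auto simp: usvt_output_def)
  have "(frobenius_norm (?M - B))\<^sup>2 = (\<Sum>i<n. \<Sum>j<n. ((?M - B) $$ (i, j))\<^sup>2)"
    by (simp add: frobenius_norm_def sum_nonneg B clip_mat_def edge_prob_mat_def)
  also have "\<dots> \<le> (\<Sum>i<n. \<Sum>j<n. 1)"
  proof (intro sum_mono)
    fix i j assume ij: "i \<in> {..<n}" "j \<in> {..<n}"
    then have "f (x i) (x j) \<in> {0..1}" using f x by simp
    then have "\<bar>(?M - B) $$ (i, j)\<bar> \<le> 1"
      using ij by (auto simp: B clip_mat_def edge_prob_mat_def min_def max_def abs_if)
    then show "((?M - B) $$ (i, j))\<^sup>2 \<le> 1" by (simp add: abs_square_le_1)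
  qed
  finally show ?thesis by (simp add: power2_eq_square)
qed

lemma prob_large_noise:
  assumes C: "C > 0" and n: "n \<ge> 1" and \<rho>: "0 < \<rho>" "\<rho> \<le> 1" and deg: "real n * \<rho> \<ge> C * ln (real n)"
    and x: "\<And>i. i < n \<Longrightarrow> x i \<in> {1..k}"
    and f: "\<And>a b. a \<in> {1..k} \<Longrightarrow> b \<in> {1..k} \<Longrightarrow> f a b \<in> {0..1} \<and> f a b = f b a"
  shows "measure_pmf.prob (edge_law n (\<lambda>ij. bernoulli_pmf (\<rho> * edge_prob_mat n f x $$ ij)))
           {e. (edge_prob_mat n f x, adjacency_mat n e) \<in> large_noise n \<rho> (conc_const C * (real n * \<rho>))}
         \<le> 1 / real n"
proof -
  define q where "q ij = \<rho> * edge_prob_mat n f x $$ ij" for ij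
  have f01: "0 \<le> f (x i) (x j)" "f (x i) (x j) \<le> 1" if "i < n" "j < n" for i j
    using f[OF x[OF that(1)] x[OF that(2)]] by auto
  have eq: "adjacency_mat n e $$ (i, j) - \<rho> * edge_prob_mat n f x $$ (i, j)
      = sym_mat (\<lambda>ij b. of_bool b - q ij) e i j" if "i < n" "j < n" for e i j
    using that f[OF x x, of i j]
    by (auto simp: adjacency_mat_index edge_prob_mat_index sym_mat_def q_def edge_def min_def max_def)
  have "{e. (edge_prob_mat n f x, adjacency_mat n e) \<in> large_noise n \<rho> (conc_const C * (real n * \<rho>))}
      = {e. \<exists>v. (\<Sum>i<n. (\<Sum>j<n. sym_mat (\<lambda>ij b. of_bool b - q ij) e i j * v j)\<^sup>2)
                  > conc_const C * (real n * \<rho>) * (\<Sum>i<n. (v i)\<^sup>2)}"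
    by (simp add: large_noise_def eq)
  also have "measure_pmf.prob (edge_law n (\<lambda>ij. bernoulli_pmf (q ij))) \<dots> \<le> 1 / real n"
  proof (rule spectral_concentration[OF C n \<rho> deg])
    fix ij assume "ij \<in> upper_pairs n"
    then show "0 \<le> q ij \<and> q ij \<le> \<rho>"
      using f01 \<rho> by (auto simp: q_def upper_pairs_def edge_prob_mat_index intro!: mult_left_le)
  qed
  finally show ?thesis by (simp add: q_def)
qed

lemma sbm_pmf_alt:
  "sbm_pmf n \<mu> f \<rho> = Pi_pmf {..<n} 0 (\<lambda>_. \<mu>) \<bind> (\<lambda>x.
     map_pmf (\<lambda>e. (edge_prob_mat n f x, adjacency_mat n e))
       (edge_law n (\<lambda>ij. bernoulli_pmf (\<rho> * edge_prob_mat n f x $$ ij))))"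
  by (simp add: sbm_pmf_def Let_def map_pmf_def upper_pairs_def)

theorem theorem2:
  fixes C :: real
  assumes "C > 0"
  shows "\<exists>\<kappa>::real. \<kappa> > 0 \<and> (\<forall>\<delta>::real. \<delta> > 0 \<longrightarrow> (\<exists>c::real. c > 0 \<and>
    (\<forall>(k::nat) (n::nat) (\<rho>::real) (\<mu>::nat pmf) (f::nat \<Rightarrow> nat \<Rightarrow> real) (Mhat::real mat \<Rightarrow> real mat).
       n \<ge> 1 \<longrightarrow> 0 < \<rho> \<longrightarrow> \<rho> \<le> 1 \<longrightarrow> real n * \<rho> \<ge> C * ln (real n) \<longrightarrow>
       sbm_kernel k \<mu> f \<longrightarrow>
       (\<forall>(M, A) \<in> set_pmf (sbm_pmf n \<mu> f \<rho>).
          usvt_output n A \<rho> ((1 + \<delta>) * \<kappa> * sqrt (real n * \<rho>)) (Mhat A)) \<longrightarrow>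
       MSE n \<mu> f \<rho> Mhat \<le> c * min (real k / (real n * \<rho>)) 1)))"
proof -
  define K where "K = conc_const C"
  have K: "K > 0" using conc_const_pos[OF assms] by (simp add: K_def)
  \<comment> \<open>With this choice \<tau>^2 is exactly (1 + \<delta>)^2 times the noise level
    \<open>L\<close> of \<open>usvt_error_bound\<close>; it depends on \<open>C\<close>
    alone.\<close>
  define \<kappa> where "\<kappa> = sqrt (2 * K + 2)"
  have \<kappa>: "\<kappa> > 0" "\<kappa>\<^sup>2 = 2 * K + 2" using K by (simp_all add: \<kappa>_def)
  show ?thesis
  proof (rule exI[of _ \<kappa>], intro conjI allI impI \<kappa>(1))
    fix \<delta> :: real assume \<delta>: "\<delta> > 0"
    define \<theta> where "\<theta> = (1 + \<delta>)\<^sup>2"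
    have \<theta>: "\<theta> > 1" using \<delta> by (simp add: \<theta>_def power2_eq_square algebra_simps add_pos_pos)
    define c1 where "c1 = 2 * (2 * \<theta> + 2 + \<theta> / (\<theta> - 1)) * (2 * K + 2)"
    have c1: "c1 > 0" using \<theta> K by (auto simp: c1_def intro!: mult_pos_pos add_pos_pos)
    show "\<exists>c::real. c > 0 \<and>
    (\<forall>(k::nat) (n::nat) (\<rho>::real) (\<mu>::nat pmf) (f::nat \<Rightarrow> nat \<Rightarrow> real) (Mhat::real mat \<Rightarrow> real mat).
       n \<ge> 1 \<longrightarrow> 0 < \<rho> \<longrightarrow> \<rho> \<le> 1 \<longrightarrow> real n * \<rho> \<ge> C * ln (real n) \<longrightarrow>
       sbm_kernel k \<mu> f \<longrightarrow>
       (\<forall>(M, A) \<in> set_pmf (sbm_pmf n \<mu> f \<rho>).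
          usvt_output n A \<rho> ((1 + \<delta>) * \<kappa> * sqrt (real n * \<rho>)) (Mhat A)) \<longrightarrow>
       MSE n \<mu> f \<rho> Mhat \<le> c * min (real k / (real n * \<rho>)) 1)"
    \<comment> \<open>\<open>c1\<close> pays for small noise and the extra 1 for the exceptional
      event; it also makes the constant at least 1 for the second branch of the minimum.\<close>
    proof (intro exI[of _ "c1 + 1"] conjI allI impI)
      show "c1 + 1 > 0" using c1 by simp
    next
      fix k n :: nat and \<rho> :: real and \<mu> :: "nat pmf" and f :: "nat \<Rightarrow> nat \<Rightarrow> real"
        and Mhat :: "real mat \<Rightarrow> real mat"
      assume n: "n \<ge> 1" and \<rho>: "0 < \<rho>" "\<rho> \<le> 1" and deg: "C * ln (real n) \<le> real n * \<rho>"
        and ker: "sbm_kernel k \<mu> f"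
        and out: "\<forall>(M, A) \<in> set_pmf (sbm_pmf n \<mu> f \<rho>).
          usvt_output n A \<rho> ((1 + \<delta>) * \<kappa> * sqrt (real n * \<rho>)) (Mhat A)"
      let ?\<tau> = "(1 + \<delta>) * \<kappa> * sqrt (real n * \<rho>)"
      let ?S = "sbm_pmf n \<mu> f \<rho>" and ?X = "Pi_pmf {..<n} 0 (\<lambda>_. \<mu>)"
      let ?h = "\<lambda>(M, A). (frobenius_norm (M - Mhat A))\<^sup>2"
      let ?Bad = "large_noise n \<rho> (K * (real n * \<rho>))"
      define b where "b = c1 * (real n * real k / \<rho>)"
      have f: "\<And>a b. a \<in> {1..k} \<Longrightarrow> b \<in> {1..k} \<Longrightarrow> f a b \<in> {0..1} \<and> f a b = f b a"
        and \<mu>: "set_pmf \<mu> \<subseteq> {1..k}"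
        using ker by (auto simp: sbm_kernel_def)
      \<comment> \<open>Needed to absorb the 1 / n of the exceptional event into k / (n
        \<rho>).\<close>
      have k: "k \<ge> 1"
        using \<mu> set_pmf_not_empty[of \<mu>] by (cases k) auto
      have \<tau>: "?\<tau> > 0" "?\<tau>\<^sup>2 = \<theta> * ((2 * K + 2) * (real n * \<rho>))"
        using \<delta> \<kappa> n \<rho> by (simp_all add: \<theta>_def power_mult_distrib)
      have x: "x i \<in> {1..k}" if "x \<in> set_pmf ?X" "i < n" for x i
        using that \<mu> by (auto simp: set_Pi_pmf PiE_dflt_def)
      have fin\<mu>: "finite (set_pmf \<mu>)" using \<mu> by (rule finite_subset) simp
      \<comment> \<open>Finite support makes every real function integrable, including the error of
        an arbitrary \<open>Mhat\<close>.\<close>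
      have finS: "finite (set_pmf ?S)"
        unfolding sbm_pmf_alt using fin\<mu>
        by (auto intro!: finite_set_Pi_pmf finite_UN_I)
      have support: "\<exists>x e. (\<forall>i<n. x i \<in> {1..k}) \<and> M = edge_prob_mat n f x \<and> A = adjacency_mat n e"
        if "(M, A) \<in> set_pmf ?S" for M A
        using that x unfolding sbm_pmf_alt by (auto; blast)
      have h_le: "?h (M, A) \<le> b + (real n)\<^sup>2 * indicator ?Bad (M, A)"
        and h_le': "?h (M, A) \<le> (real n)\<^sup>2" if MA: "(M, A) \<in> set_pmf ?S" for M A
      proof -
        obtain y e where y: "\<And>i. i < n \<Longrightarrow> y i \<in> {1..k}"
          and M: "M = edge_prob_mat n f y" and A: "A = adjacency_mat n e"
          using support[OF MA] by blast
        have o: "usvt_output n A \<rho> ?\<tau> (Mhat A)" using out MA by auto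
        show le: "?h (M, A) \<le> (real n)\<^sup>2"
          using frobenius_error_le_square[where f = f, OF y _ o] f by (simp add: M)
        show "?h (M, A) \<le> b + (real n)\<^sup>2 * indicator ?Bad (M, A)"
        proof (cases "(M, A) \<in> ?Bad")
          case True
          have "b \<ge> 0" using c1 \<rho> by (simp add: b_def)
          then show ?thesis using le True by simp
        next
          case False
          then show ?thesis
            using usvt_error_bound[where e = e and B = "Mhat A", OF y f n \<rho> K \<theta> \<tau>] o
            by (simp add: M A b_def c1_def)
        qed
      qed
      \<comment> \<open>The conditional bound is uniform over the label vectors in the support, so
        it survives averaging over them.\<close>
      have bad: "measure_pmf.prob ?S ?Bad \<le> 1 / real n"
      proof -
        have "emeasure (measure_pmf ?S) ?Bad
            = (\<integral>\<^sup>+x. emeasure (measure_pmf (edge_law n (\<lambda>ij. bernoulli_pmf (\<rho> * edge_prob_mat n f x $$ ij))))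
                 {e. (edge_prob_mat n f x, adjacency_mat n e) \<in> ?Bad} \<partial>measure_pmf ?X)"
          by (simp add: sbm_pmf_alt vimage_def)
        also have "\<dots> \<le> (\<integral>\<^sup>+x. ennreal (1 / real n) \<partial>measure_pmf ?X)"
          using prob_large_noise[OF assms n \<rho> deg x f]
          by (intro nn_integral_mono_AE AE_pmfI)
             (auto simp: measure_pmf.emeasure_eq_measure K_def intro!: ennreal_leI)
        also have "\<dots> = ennreal (1 / real n)" by simp
        finally show ?thesis by (simp add: measure_pmf.emeasure_eq_measure)
      qed
      have int: "integrable (measure_pmf ?S) g" for g :: "_ \<Rightarrow> real"
        by (rule integrable_measure_pmf_finite[OF finS])
      have "measure_pmf.expectation ?S ?h
          \<le> measure_pmf.expectation ?S (\<lambda>MA. b + (real n)\<^sup>2 * indicator ?Bad MA)"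
        using h_le by (intro integral_mono_AE int AE_pmfI) auto
      also have "\<dots> = b + (real n)\<^sup>2 * measure_pmf.prob ?S ?Bad"
        by (subst Bochner_Integration.integral_add[OF int int]) simp
      also have "\<dots> \<le> b + (real n)\<^sup>2 * (1 / real n)"
        using bad by (intro add_left_mono mult_left_mono) auto
      finally have "MSE n \<mu> f \<rho> Mhat \<le> 1 / (real n)\<^sup>2 * (b + (real n)\<^sup>2 * (1 / real n))"
        unfolding MSE_def by (intro mult_left_mono) auto
      also have "\<dots> = c1 * (real k / (real n * \<rho>)) + 1 / real n"
        using n \<rho> by (simp add: b_def field_simps power2_eq_square)
      also have "1 / real n \<le> real k / (real n * \<rho>)"
        using n \<rho> k by (intro frac_le) (auto intro: mult_left_le)
      finally have 1: "MSE n \<mu> f \<rho> Mhat \<le> (c1 + 1) * (real k / (real n * \<rho>))"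
        by (simp only: distrib_right mult_1_left)
      have "measure_pmf.expectation ?S ?h \<le> measure_pmf.expectation ?S (\<lambda>_. (real n)\<^sup>2)"
        using h_le' by (intro integral_mono_AE int AE_pmfI) auto
      then have "MSE n \<mu> f \<rho> Mhat \<le> 1 / (real n)\<^sup>2 * (real n)\<^sup>2"
        unfolding MSE_def by (intro mult_left_mono) auto
      also have "\<dots> \<le> c1 + 1" using n c1 by simp
      finally show "MSE n \<mu> f \<rho> Mhat \<le> (c1 + 1) * min (real k / (real n * \<rho>)) 1"
        using 1 by (simp add: min_def)
    qed
  qed
qed

end
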